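(* Let $m\ge 1$ and let $\tilde G_{c,nom}$, $G_v=\frac{1}{sC}$, $K_v$, $K_r$, $D'\in(0,1)$ and $\eta\ge 0$ be as described in the context. Consider (S) the single-converter system with inner-shaped plant $\tilde G_{c,nom}$, outer controllers $K_v$, $K_r$, droop coefficient $\eta$ and exogenous signals $V_{\text{ref}}, i_{\text{ref}}, i_{\text{load}}$; and (M) the $m$-converter parallel system in which every converter $k=1,\dots,m$ has inner-shaped plant $\tilde G_{c_k}=\tilde G_{c,nom}$ and outer controllers $K_{v_k}=\frac1m K_v$, $K_{r_k}=K_r$, with the same droop coefficient $\eta$, the same exogenous signals $V_{\text{ref}}, i_{\text{load}}$, and the reference current $i_{\text{ref}}$ prescaled by time-varying scalars $\gamma_k>0$, $1\le k\le m$ (the equations of both systems are given in the context). **1. (System equivalence)** If $\sum_{k=1}^m\gamma_k=1$, then (S) and (M) are equivalent, i.e. the transfer functions from $V_{\text{ref}}$, from $i_{\text{ref}}$ and from $i_{\text{load}}$ to the DC-link voltage $V$ in (M) are identical to the corresponding transfer functions in (S). **2. (Power sharing)** For any two converters $k,l\in\{1,\dots,m\}$ of (M), the difference in the corresponding steady-state scaled output currents satisfies $$\left|\frac{D_k'i_{L_k}(j0)}{\gamma_k}-\frac{D_l'i_{L_l}(j0)}{\gamma_l}\right|\le\left(\eta\,|\tilde T_1(j0)|+\left|\frac1{\gamma_k}-\frac1{\gamma_l}\right||\tilde T_2(j0)|\right)|e_1(j0)|,$$ where $$\tilde T_1:=\frac{D'\tilde G_{c,nom}K_r}{1+D'\tilde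 G_{c,nom}K_r},\qquad \tilde T_2:=\frac{D'\tilde G_{c,nom}K_v}{m\,(1+D'\tilde G_{c,nom}K_r)}.$$ Furthermore, the steady-state tracking error $e_1:=V_{\text{ref}}-V$ in the DC-link voltage is upper bounded as follows. (a) Centralized case, $i_{\text{ref}}=i_{\text{load}}$: $$|e_1(j0)|\le\frac{1}{D'\,|K_v(j0)+\eta K_r(j0)|}\,|i_{\text{ref}}(j0)|.$$ (b) Decentralized case, $i_{\text{ref}}\ne i_{\text{load}}$: $$|e_1(j0)|\le\frac{|K_r(j0)|}{D'\,|K_v(j0)+\eta K_r(j0)|}\,|i_{\text{ref}}(j0)|+\frac{D'|K_r(j0)|+1}{D'\,|K_v(j0)+\eta K_r(j0)|}\,|i_{\text{load}}(j0)|.$$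
   Context: All systems are linear, scalar-block feedback systems with zero initial conditions, described by Laplace-domain transfer functions. Data. $C>0$ is the DC-link capacitance and $G_v(s)=\frac{1}{sC}$. $D'=V_g/V_{\text{ref}}$ is the nominal complementary duty cycle of a boost converter with input voltage $V_g$ (output voltage larger than input voltage), so $0<D'<1$. The droop coefficient is a constant $\eta\ge0$. The inner-shaped plant is $$\tilde G_{c,nom}(s)=\left(\frac{\tilde\omega}{s+\tilde\omega}\right)\left(\frac{s^2+2\zeta_{1,nom}\omega_0s+\omega_0^2}{s^2+2\zeta_{2,nom}\omega_0s+\omega_0^2}\right),$$ with $\omega_0=2\pi\cdot120$, $\tilde\omega>\omega_0$, $\zeta_{1,nom},\zeta_{2,nom}>0$. The outer controllers $K_v,K_r$ are proper real rational transfer functions with finite values at $s=0$. The quantities appearing in denominators at $s=0$, namely $1+D'K_r(0)$ and $K_v(0)+\eta K_r(0)$, are nonzero. Single-converter system (S). With exogenous signals $V_{\text{ref}}$ (desired DC-link voltage), $i_{\text{ref}}$ (reference current), $i_{\text{load}}$ (load current), and output $V$ (DC-link voltage): $$e_1=V_{\text{ref}}-V,\quad e_2=i_{\text{ref}}+\eta e_1-D'i_L,\quad \hat u=K_ve_1+K_re_2,\quad i_L=\tilde G_{c,nom}\hat u,\quad V=G_v\left(-i_{\text{load}}+D'i_L\right).$$ Multi-converter system (M). For $k=1,\dots,m$, the output current of converter $k$ is $i_k=D_k'i_{L_k}$ ($i_{L_k}$ is the inductor current and $D'_k$ the complementary duty cycle of converter $k$), and $$e_1=V_{\text{ref}}-V,\quad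 e_2^{(k)}=\gamma_k\left(i_{\text{ref}}+\eta e_1\right)-i_k,\quad i_k=D_k'i_{L_k}=D'\tilde G_{c,nom}\left(\tfrac1mK_ve_1+K_re_2^{(k)}\right),\quad V=G_v\left(-i_{\text{load}}+\sum_{k=1}^m i_k\right).$$ Here $\gamma_k$ represents the proportion of power demanded from source $k$. It acts by pointwise multiplication in time on the signal $i_{\text{ref}}+\eta e_1$. The multipliers in this architecture satisfy $0\le\gamma_k\le1$. Steady-state notation. For a transfer function $T$, $T(j0)$ denotes its DC gain, i.e. $\lim_{s\to0}T(s)$. In Part 2 the $\gamma_k>0$ are taken at constant (steady-state) values. For an exogenous signal $x$, $x(j0)$ denotes its steady-state (DC) value. For an internal signal of the closed loop (such as $e_1$ or $D_k'i_{L_k}$), the argument $(j0)$ denotes its steady-state value, i.e. the value obtained by applying the DC gains of the closed-loop transfer functions from $(V_{\text{ref}},i_{\text{ref}},i_{\text{load}})$ to that signal to the DC values of $V_{\text{ref}},i_{\text{ref}},i_{\text{load}}$.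
   Formalization: The bounds (a), (b) on the tracking error are proved for multipliers with sum of gamma_k equal to 1, as in Part 1; without this (a) fails, e.g. m=1, gamma_1=1/2, eta=0, K_v(0), K_r(0)>0, i_ref=i_load. *)

theory Defs
  imports "HOL-Analysis.Analysis" "HOL-Computational_Algebra.Polynomial"
begin

text \<open>
  Signals are real functions of time; only their values at times \<open>t \<ge> 0\<close> matter.  The growth
  condition makes the Laplace integral absolutely convergent on some right half-plane.
\<close>

definition signal :: "(real \<Rightarrow> real) \<Rightarrow> bool" where
  "signal x \<longleftrightarrow> set_borel_measurable borel {0..} x \<and>
     (\<exists>M a. \<forall>t\<ge>0. \<bar>x t\<bar> \<le> M * exp (a * t))"

definition laplace :: "(real \<Rightarrow> real) \<Rightarrow> complex \<Rightarrow> complex" where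
  "laplace x s = (LINT t:{0..}|lborel. exp (- s * of_real t) * of_real (x t))"

text \<open>
  The block with transfer function \<open>T\<close>, at zero initial conditions, maps \<open>u\<close> to \<open>y\<close>.
  The identity of transforms is required on some right half-plane, which may depend on the signals.
\<close>

definition block :: "(complex \<Rightarrow> complex) \<Rightarrow> (real \<Rightarrow> real) \<Rightarrow> (real \<Rightarrow> real) \<Rightarrow> bool" where
  "block T u y \<longleftrightarrow> signal u \<and> signal y \<and>
     (\<exists>\<sigma>. \<forall>s. Re s > \<sigma> \<longrightarrow> laplace y s = T s * laplace u s)"

definition real_rational :: "(complex \<Rightarrow> complex) \<Rightarrow> bool" where
  "real_rational T \<longleftrightarrow> (\<exists>p q :: real poly. q \<noteq> 0 \<and>
     (\<forall>s. T s = poly (map_poly of_real p) s / poly (map_poly of_real q) s))"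

definition proper_real_rational :: "(complex \<Rightarrow> complex) \<Rightarrow> bool" where
  "proper_real_rational T \<longleftrightarrow> (\<exists>p q :: real poly. q \<noteq> 0 \<and> degree p \<le> degree q \<and>
     (\<forall>s. T s = poly (map_poly of_real p) s / poly (map_poly of_real q) s))"

text \<open>
  An input-output relation \<open>R\<close> has transfer function \<open>T\<close>: every input has an output, and every
  output has transform \<open>T\<close> times that of the input.  \<open>T\<close> is unique as a rational function; as a
  HOL function it is unique up to its values at finitely many points (poles and removable
  singularities of the chosen quotient of polynomials).
\<close>

definition is_transfer_function ::
  "((real \<Rightarrow> real) \<Rightarrow> (real \<Rightarrow> real) \<Rightarrow> bool) \<Rightarrow> (complex \<Rightarrow> complex) \<Rightarrow> bool" where
  "is_transfer_function R T \<longleftrightarrow> real_rational T \<and>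
     (\<forall>u. signal u \<longrightarrow> (\<exists>y. R u y)) \<and>
     (\<forall>u y. signal u \<and> R u y \<longrightarrow> block T u y)"

text \<open>
  A behaviour relates \<open>V\<^sub>r\<^sub>e\<^sub>f\<close>, \<open>i\<^sub>r\<^sub>e\<^sub>f\<close>, \<open>i\<^sub>l\<^sub>o\<^sub>a\<^sub>d\<close> (in this order) and one further signal.
  In each channel the two other exogenous signals are zero.
\<close>

type_synonym behaviour =
  "(real \<Rightarrow> real) \<Rightarrow> (real \<Rightarrow> real) \<Rightarrow> (real \<Rightarrow> real) \<Rightarrow> (real \<Rightarrow> real) \<Rightarrow> bool"

definition from_vref :: "behaviour \<Rightarrow> (real \<Rightarrow> real) \<Rightarrow> (real \<Rightarrow> real) \<Rightarrow> bool" where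
  "from_vref B u y \<longleftrightarrow> B u (\<lambda>_. 0) (\<lambda>_. 0) y"

definition from_iref :: "behaviour \<Rightarrow> (real \<Rightarrow> real) \<Rightarrow> (real \<Rightarrow> real) \<Rightarrow> bool" where
  "from_iref B u y \<longleftrightarrow> B (\<lambda>_. 0) u (\<lambda>_. 0) y"

definition from_iload :: "behaviour \<Rightarrow> (real \<Rightarrow> real) \<Rightarrow> (real \<Rightarrow> real) \<Rightarrow> bool" where
  "from_iload B u y \<longleftrightarrow> B (\<lambda>_. 0) (\<lambda>_. 0) u y"

definition dc_gain :: "(complex \<Rightarrow> complex) \<Rightarrow> complex" where
  "dc_gain T = Lim (at 0) T"

text \<open>
  \<open>x\<close> is the steady-state value of the last signal of \<open>B\<close> when the exogenous signals have the DC
  values \<open>v\<close>, \<open>r\<close>, \<open>l\<close>.  It exists only if the three closed-loop DC gains do.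
\<close>

definition steady_state :: "behaviour \<Rightarrow> real \<Rightarrow> real \<Rightarrow> real \<Rightarrow> complex \<Rightarrow> bool" where
  "steady_state B v r l x \<longleftrightarrow> (\<exists>Tv Tr Tl gv gr gl.
     is_transfer_function (from_vref B) Tv \<and> (Tv \<longlongrightarrow> gv) (at 0) \<and>
     is_transfer_function (from_iref B) Tr \<and> (Tr \<longlongrightarrow> gr) (at 0) \<and>
     is_transfer_function (from_iload B) Tl \<and> (Tl \<longlongrightarrow> gl) (at 0) \<and>
     x = gv * of_real v + gr * of_real r + gl * of_real l)"

definition omega0 :: real where
  "omega0 = 2 * pi * 120"

definition inner_plant :: "real \<Rightarrow> real \<Rightarrow> real \<Rightarrow> complex \<Rightarrow> complex" where
  "inner_plant \<omega> \<zeta>1 \<zeta>2 s =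
     (of_real \<omega> / (s + of_real \<omega>)) *
     ((s^2 + 2 * of_real \<zeta>1 * of_real omega0 * s + (of_real omega0)^2) /
      (s^2 + 2 * of_real \<zeta>2 * of_real omega0 * s + (of_real omega0)^2))"

definition dc_link :: "real \<Rightarrow> complex \<Rightarrow> complex" where
  "dc_link C s = 1 / (s * of_real C)"

definition single_system ::
  "real \<Rightarrow> real \<Rightarrow> real \<Rightarrow> (complex \<Rightarrow> complex) \<Rightarrow> (complex \<Rightarrow> complex) \<Rightarrow> (complex \<Rightarrow> complex) \<Rightarrow>
   (real \<Rightarrow> real) \<Rightarrow> (real \<Rightarrow> real) \<Rightarrow> (real \<Rightarrow> real) \<Rightarrow>
   (real \<Rightarrow> real) \<Rightarrow> (real \<Rightarrow> real) \<Rightarrow> (real \<Rightarrow> real) \<Rightarrow> (real \<Rightarrow> real) \<Rightarrow> (real \<Rightarrow> real) \<Rightarrow> bool" where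
  "single_system C D' \<eta> G Kv Kr vref iref iload e1 e2 u iL V \<longleftrightarrow>
     (\<forall>t\<ge>0. e1 t = vref t - V t) \<and>
     (\<forall>t\<ge>0. e2 t = iref t + \<eta> * e1 t - D' * iL t) \<and>
     (\<exists>w z. block Kv e1 w \<and> block Kr e2 z \<and> (\<forall>t\<ge>0. u t = w t + z t)) \<and>
     block G u iL \<and>
     block (dc_link C) (\<lambda>t. - iload t + D' * iL t) V"

definition single_V ::
  "real \<Rightarrow> real \<Rightarrow> real \<Rightarrow> (complex \<Rightarrow> complex) \<Rightarrow> (complex \<Rightarrow> complex) \<Rightarrow> (complex \<Rightarrow> complex) \<Rightarrow>
   behaviour" where
  "single_V C D' \<eta> G Kv Kr vref iref iload V \<longleftrightarrow>
     (\<exists>e1 e2 u iL. single_system C D' \<eta> G Kv Kr vref iref iload e1 e2 u iL V)"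

text \<open>
  The converters are indexed by \<open>1, \<dots>, m\<close>; \<open>Dk k\<close> is the complementary duty cycle of converter \<open>k\<close>.
  The multipliers \<open>\<gamma> k\<close> are functions of time.
\<close>

definition multi_system ::
  "nat \<Rightarrow> real \<Rightarrow> real \<Rightarrow> (nat \<Rightarrow> real) \<Rightarrow> real \<Rightarrow> (nat \<Rightarrow> real \<Rightarrow> real) \<Rightarrow>
   (complex \<Rightarrow> complex) \<Rightarrow> (complex \<Rightarrow> complex) \<Rightarrow> (complex \<Rightarrow> complex) \<Rightarrow>
   (real \<Rightarrow> real) \<Rightarrow> (real \<Rightarrow> real) \<Rightarrow> (real \<Rightarrow> real) \<Rightarrow>
   (real \<Rightarrow> real) \<Rightarrow> (nat \<Rightarrow> real \<Rightarrow> real) \<Rightarrow> (nat \<Rightarrow> real \<Rightarrow> real) \<Rightarrow> (nat \<Rightarrow> real \<Rightarrow> real) \<Rightarrow>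
   (real \<Rightarrow> real) \<Rightarrow> bool" where
  "multi_system m C D' Dk \<eta> \<gamma> G Kv Kr vref iref iload e1 e2 i iL V \<longleftrightarrow>
     (\<forall>t\<ge>0. e1 t = vref t - V t) \<and>
     (\<forall>k\<in>{1..m}.
        (\<forall>t\<ge>0. e2 k t = \<gamma> k t * (iref t + \<eta> * e1 t) - i k t) \<and>
        (\<forall>t\<ge>0. i k t = Dk k * iL k t) \<and>
        (\<exists>w z. block (\<lambda>s. Kv s / of_nat m) e1 w \<and> block Kr (e2 k) z \<and>
           block (\<lambda>s. of_real D' * G s) (\<lambda>t. w t + z t) (i k))) \<and>
     block (dc_link C) (\<lambda>t. - iload t + (\<Sum>k=1..m. i k t)) V"

definition multi_V ::
  "nat \<Rightarrow> real \<Rightarrow> real \<Rightarrow> (nat \<Rightarrow> real) \<Rightarrow> real \<Rightarrow> (nat \<Rightarrow> real \<Rightarrow> real) \<Rightarrow>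
   (complex \<Rightarrow> complex) \<Rightarrow> (complex \<Rightarrow> complex) \<Rightarrow> (complex \<Rightarrow> complex) \<Rightarrow> behaviour" where
  "multi_V m C D' Dk \<eta> \<gamma> G Kv Kr vref iref iload V \<longleftrightarrow>
     (\<exists>e1 e2 i iL. multi_system m C D' Dk \<eta> \<gamma> G Kv Kr vref iref iload e1 e2 i iL V)"

definition multi_e1 ::
  "nat \<Rightarrow> real \<Rightarrow> real \<Rightarrow> (nat \<Rightarrow> real) \<Rightarrow> real \<Rightarrow> (nat \<Rightarrow> real \<Rightarrow> real) \<Rightarrow>
   (complex \<Rightarrow> complex) \<Rightarrow> (complex \<Rightarrow> complex) \<Rightarrow> (complex \<Rightarrow> complex) \<Rightarrow> behaviour" where
  "multi_e1 m C D' Dk \<eta> \<gamma> G Kv Kr vref iref iload e1 \<longleftrightarrow>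
     (\<exists>e2 i iL V. multi_system m C D' Dk \<eta> \<gamma> G Kv Kr vref iref iload e1 e2 i iL V)"

definition multi_current ::
  "nat \<Rightarrow> real \<Rightarrow> real \<Rightarrow> (nat \<Rightarrow> real) \<Rightarrow> real \<Rightarrow> (nat \<Rightarrow> real \<Rightarrow> real) \<Rightarrow>
   (complex \<Rightarrow> complex) \<Rightarrow> (complex \<Rightarrow> complex) \<Rightarrow> (complex \<Rightarrow> complex) \<Rightarrow> nat \<Rightarrow> behaviour" where
  "multi_current m C D' Dk \<eta> \<gamma> G Kv Kr k vref iref iload y \<longleftrightarrow>
     (\<exists>e1 e2 i iL V. multi_system m C D' Dk \<eta> \<gamma> G Kv Kr vref iref iload e1 e2 i iL V \<and>
        y = (\<lambda>t. Dk k * iL k t))"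

definition T1_tilde ::
  "real \<Rightarrow> (complex \<Rightarrow> complex) \<Rightarrow> (complex \<Rightarrow> complex) \<Rightarrow> complex \<Rightarrow> complex" where
  "T1_tilde D' G Kr s = of_real D' * G s * Kr s / (1 + of_real D' * G s * Kr s)"

definition T2_tilde ::
  "nat \<Rightarrow> real \<Rightarrow> (complex \<Rightarrow> complex) \<Rightarrow> (complex \<Rightarrow> complex) \<Rightarrow> (complex \<Rightarrow> complex) \<Rightarrow>
   complex \<Rightarrow> complex" where
  "T2_tilde m D' G Kv Kr s =
     of_real D' * G s * Kv s / (of_nat m * (1 + of_real D' * G s * Kr s))"

end

theory Submission
  imports Defs "HOL-Computational_Algebra.Fundamental_Theorem_Algebra"
begin

text \<open>
  Summing the converter equations of the parallel system, with multipliers adding up to one, gives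
  at every time the equations of the single converter for the total current, so both systems lead
  to the same equations between Laplace transforms.  Since the inner plant and the integrator are
  strictly proper, all loops are well posed: \<open>1 + D' G Kr\<close> and the outer return difference tend to
  \<open>1\<close> at infinity, so the closed-loop transfer functions are proper.  A proper rational function is
  realizable, because it is built from constants and factors \<open>1 / (s - a)\<close> by sums and products,
  and \<open>1 / (s - a)\<close> is an exponentially weighted primitive.  This yields existence of the
  responses; their uniqueness up to transforms is linear algebra on a right half-plane, and an
  identity of rational functions there carries over to a punctured neighbourhood of \<open>0\<close>.

  Dividing the equation of converter \<open>k\<close> by \<open>\<gamma> k\<close> leaves \<open>T2 e1 / \<gamma> k\<close> plus a term common to all
  converters.  Hence the difference of two scaled currents is exactly \<open>(1 / \<gamma> k - 1 / \<gamma> l) T2 e1\<close>, and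
  the \<open>T1\<close> term of the bound is slack.
\<close>

subsection \<open>Laplace transforms of complex signals\<close>

text \<open>A real rational function may have nonreal poles, so outputs are first built as complex
  signals and made real only at the end. A transfer function is a HOL function fixed only up to
  finitely many points, and transforms are compared on half-planes that depend on the signals;
  rational identities are therefore kept modulo finite sets, and transform identities modulo a
  filter. A time-varying multiplier is not a transfer function: with it only the total current, not
  the current of one converter, has an explicit gain. The integrator has a pole at \<open>0\<close>,
  yet the error has finite DC gains, because the return difference \<open>L\<close> has the same
  pole; this is where \<open>Kv + \<eta> Kr\<close> must be nonzero at DC. The power sharing bound
  concerns multipliers of any sum, to which the closed form of the error does not apply. It is
  derived instead from the transfer functions whose existence is part of
  \<open>steady_state\<close>.\<close>

definition csignal :: "(real \<Rightarrow> complex) \<Rightarrow> bool" where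
  "csignal v \<longleftrightarrow> (\<lambda>t. indicator {0..} t *\<^sub>R v t) \<in> borel_measurable lborel \<and>
     (\<exists>M a. \<forall>t\<ge>0. norm (v t) \<le> M * exp (a * t))"

definition claplace :: "(real \<Rightarrow> complex) \<Rightarrow> complex \<Rightarrow> complex" where
  "claplace v s = (LINT t:{0..}|lborel. exp (- s * of_real t) * v t)"

text \<open>As statements about a filter, finitely many transform identities combine by
  \<open>eventually_elim\<close>, without naming the abscissas from which they hold.\<close>

abbreviation rhp :: "complex filter" where
  "rhp \<equiv> filtercomap Re at_top"

lemma eventually_rhp: "eventually P rhp \<longleftrightarrow> (\<exists>\<sigma>. \<forall>s. Re s > \<sigma> \<longrightarrow> P s)"
  by (rule eventually_filtercomap_at_top_dense)

lemma eventually_rhp_gt: "\<forall>\<^sub>F s in rhp. Re s > c"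
  unfolding eventually_rhp by auto

text \<open>Nonnegative constants make the bound monotone in time and in the rate, so that two
  bounds can be brought to a common rate.\<close>

lemma csignal_bound:
  assumes "csignal v"
  obtains M a where "M \<ge> 0" "a \<ge> 0" "\<And>t. t \<ge> 0 \<Longrightarrow> norm (v t) \<le> M * exp (a * t)"
proof -
  obtain M a where b: "\<forall>t\<ge>0. norm (v t) \<le> M * exp (a * t)"
    using assms unfolding csignal_def by auto
  have M: "M \<ge> 0" using b[rule_format, of 0] norm_ge_zero[of "v 0"] by (simp del: norm_ge_zero)
  show thesis
  proof (rule that[of M "\<bar>a\<bar>"])
    fix t :: real assume t: "t \<ge> 0"
    have "M * exp (a * t) \<le> M * exp (\<bar>a\<bar> * t)"
      using t M by (intro mult_left_mono) (auto intro: mult_right_mono)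
    with b t show "norm (v t) \<le> M * exp (\<bar>a\<bar> * t)" by fastforce
  qed (use M in auto)
qed

lemma csignal_integrable_aux:
  assumes "csignal v" "a < Re s" "\<And>t. t \<ge> 0 \<Longrightarrow> norm (v t) \<le> M * exp (a * t)"
  shows "set_integrable lborel {0..} (\<lambda>t. exp (- s * of_real t) * v t)"
proof -
  define b where "b = Re s - a"
  have b: "b > 0" using assms by (simp add: b_def)
  have "set_integrable lborel {0..} (\<lambda>t. M * exp (- b * t))"
  proof -
    have "(\<lambda>x. exp (- b * x)) integrable_on {0..}"
      using integrable_on_exp_minus_to_infinity[OF b, of 0] .
    \<comment> \<open>A gauge integral of a nonnegative function is a Lebesgue integral; Borel
      measurability then allows the passage from the completed measure to
      \<open>lborel\<close>.\<close>
    then have "(\<lambda>x. exp (- b * x)) absolutely_integrable_on {0..}"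
      by (intro nonnegative_absolutely_integrable_1) auto
    then have "set_integrable lborel {0..} (\<lambda>x. exp (- b * x))"
      unfolding set_integrable_def by (subst (asm) integrable_completion) auto
    then show ?thesis by simp
  qed
  moreover have "set_borel_measurable lborel {0..} (\<lambda>t. exp (- s * of_real t) * v t)"
  proof -
    have "(\<lambda>t. exp (- s * of_real t) * (indicator {0..} t *\<^sub>R v t)) \<in> borel_measurable lborel"
      using assms(1) unfolding csignal_def by (intro borel_measurable_times) auto
    then show ?thesis unfolding set_borel_measurable_def by (simp add: mult_ac)
  qed
  ultimately show ?thesis
  proof (rule set_integrable_bound, intro AE_I2 impI)
    fix t :: real assume "t \<in> {0..}"
    then have "norm (exp (- s * of_real t) * v t) \<le> exp (- Re s * t) * (M * exp (a * t))"
      using assms(3)[of t] by (auto simp: norm_mult intro!: mult_mono)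
    also have "\<dots> = M * exp (- b * t)"
      by (simp add: b_def exp_add[symmetric] algebra_simps)
    finally show "norm (exp (- s * of_real t) * v t) \<le> norm (M * exp (- b * t))"
      by simp
  qed
qed

lemma csignal_integrable:
  assumes "csignal v"
  shows "\<forall>\<^sub>F s in rhp. set_integrable lborel {0..} (\<lambda>t. exp (- s * of_real t) * v t)"
proof -
  obtain M a where b: "\<And>t. t \<ge> 0 \<Longrightarrow> norm (v t) \<le> M * exp (a * t)"
    using csignal_bound[OF assms] by metis
  show ?thesis
    using eventually_rhp_gt[of a] by eventually_elim (rule csignal_integrable_aux[OF assms _ b])
qed

lemma csignal_const: "csignal (\<lambda>_. c)"
  unfolding csignal_def by (intro conjI exI[of _ "norm c"] exI[of _ 0]) auto

lemma csignal_mult: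
  assumes "csignal v" "csignal w"
  shows "csignal (\<lambda>t. v t * w t)"
proof -
  obtain M a N b where b: "M \<ge> 0" "\<And>t. t \<ge> 0 \<Longrightarrow> norm (v t) \<le> M * exp (a * t)"
    "\<And>t. t \<ge> 0 \<Longrightarrow> norm (w t) \<le> N * exp (b * t)"
    using csignal_bound[OF assms(1)] csignal_bound[OF assms(2)] by metis
  have "(\<lambda>t. (indicator {0..} t *\<^sub>R v t) * (indicator {0..} t *\<^sub>R w t)) \<in> borel_measurable lborel"
    using assms unfolding csignal_def by (intro borel_measurable_times) auto
  also have "(\<lambda>t. (indicator {0..} t *\<^sub>R v t) * (indicator {0..} t *\<^sub>R w t)) =
      (\<lambda>t. indicator {0..} t *\<^sub>R (v t * w t))"
    by (auto simp: fun_eq_iff indicator_def)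
  finally have "(\<lambda>t. indicator {0..} t *\<^sub>R (v t * w t)) \<in> borel_measurable lborel" .
  moreover have "norm (v t * w t) \<le> (M * N) * exp ((a + b) * t)" if "t \<ge> 0" for t
  proof -
    have "norm (v t * w t) \<le> (M * exp (a * t)) * (N * exp (b * t))"
      unfolding norm_mult using b that by (intro mult_mono) auto
    then show ?thesis by (simp add: exp_add algebra_simps)
  qed
  ultimately show ?thesis unfolding csignal_def by blast
qed

lemma csignal_add:
  assumes "csignal v" "csignal w"
  shows "csignal (\<lambda>t. v t + w t)"
proof -
  obtain M a N b where b: "M \<ge> 0" "a \<ge> 0" "\<And>t. t \<ge> 0 \<Longrightarrow> norm (v t) \<le> M * exp (a * t)"
    "N \<ge> 0" "b \<ge> 0" "\<And>t. t \<ge> 0 \<Longrightarrow> norm (w t) \<le> N * exp (b * t)"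
    using csignal_bound[OF assms(1)] csignal_bound[OF assms(2)] by metis
  have "(\<lambda>t. (indicator {0..} t *\<^sub>R v t) + (indicator {0..} t *\<^sub>R w t)) \<in> borel_measurable lborel"
    using assms unfolding csignal_def by (intro borel_measurable_add) auto
  then have "(\<lambda>t. indicator {0..} t *\<^sub>R (v t + w t)) \<in> borel_measurable lborel"
    by (simp add: scaleR_add_right)
  moreover have "norm (v t + w t) \<le> (M + N) * exp ((a + b) * t)" if t: "t \<ge> 0" for t
  proof -
    have "M * exp (a * t) \<le> M * exp ((a + b) * t)" "N * exp (b * t) \<le> N * exp ((a + b) * t)"
      using b t by (auto intro!: mult_left_mono simp: algebra_simps)
    with b(3,6)[OF t] norm_triangle_ineq[of "v t" "w t"] show ?thesis
      unfolding distrib_right by linarith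
  qed
  ultimately show ?thesis unfolding csignal_def by blast
qed

lemma csignal_exp: "csignal (\<lambda>t. exp (a * of_real t))"
  unfolding csignal_def by (intro conjI exI[of _ 1] exI[of _ "Re a"]) (auto simp: norm_exp_eq_Re)

lemma claplace_add:
  assumes "csignal v" "csignal w"
  shows "\<forall>\<^sub>F s in rhp. claplace (\<lambda>t. v t + w t) s = claplace v s + claplace w s"
  using csignal_integrable[OF assms(1)] csignal_integrable[OF assms(2)]
  by eventually_elim (simp add: claplace_def distrib_left set_integral_add)

lemma claplace_cmult: "claplace (\<lambda>t. c * v t) s = c * claplace v s"
proof -
  have "(\<lambda>t. exp (- s * of_real t) * (c * v t)) = (\<lambda>t. c * (exp (- s * of_real t) * v t))"
    by (simp add: mult_ac)
  then show ?thesis unfolding claplace_def by simp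
qed

lemma claplace_exp_mult: "claplace (\<lambda>t. exp (a * of_real t) * v t) s = claplace v (s - a)"
proof -
  have "exp (- s * of_real t) * (exp (a * of_real t) * v t) = exp (- (s - a) * of_real t) * v t" for t
    unfolding mult.assoc[symmetric] exp_add[symmetric] by (simp add: algebra_simps)
  then show ?thesis by (simp only: claplace_def)
qed

text \<open>\<open>- exp (- s t) / s\<close> is a primitive that vanishes at infinity, because its
  norm decays at the rate \<open>Re s\<close>. The tail is open at \<open>c\<close> to match the
  sections \<open>\<tau> < t\<close> in \<open>claplace_primitive\<close>.\<close>

lemma exp_tail:
  assumes "Re s > 0"
  shows "set_integrable lborel {c<..} (\<lambda>t. exp (- s * of_real t))"
    and "(LINT t:{c<..}|lborel. exp (- s * of_real t)) = exp (- s * of_real c) / s"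
proof -
  have "set_integrable lborel {c..} (\<lambda>t. exp (- Re s * t))"
  proof -
    have "(\<lambda>x. exp (- Re s * x)) integrable_on {c..}"
      using integrable_on_exp_minus_to_infinity[OF assms, of c] .
    then have "(\<lambda>x. exp (- Re s * x)) absolutely_integrable_on {c..}"
      by (intro nonnegative_absolutely_integrable_1) auto
    then show ?thesis
      unfolding set_integrable_def by (subst (asm) integrable_completion) auto
  qed
  then have "set_integrable lborel {c<..} (\<lambda>t. exp (- Re s * t))"
    by (rule set_integrable_subset) auto
  then show 1: "set_integrable lborel {c<..} (\<lambda>t. exp (- s * of_real t))"
    by (rule set_integrable_bound) (auto simp: set_borel_measurable_def)
  have s: "s \<noteq> 0" using assms by auto
  have "(LBINT t=ereal c..\<infinity>. exp (- s * of_real t)) = 0 - (- exp (- s * of_real c) / s)"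
  proof (rule interval_integral_FTC_integrable[where F = "\<lambda>t. - exp (- s * of_real t) / s"])
    show "((\<lambda>t. - exp (- s * complex_of_real t) / s) has_vector_derivative
        exp (- s * complex_of_real x)) (at x)" for x
      using s by (auto intro!: derivative_eq_intros has_vector_derivative_real_field)
    show "(((\<lambda>t. - exp (- s * complex_of_real t) / s) \<circ> real_of_ereal) \<longlongrightarrow>
        - exp (- s * of_real c) / s) (at_right (ereal c))"
      unfolding ereal_tendsto_simps by (auto intro!: tendsto_eq_intros simp: s)
    show "(((\<lambda>t. - exp (- s * complex_of_real t) / s) \<circ> real_of_ereal) \<longlongrightarrow> 0) (at_left \<infinity>)"
      unfolding ereal_tendsto_simps
    proof (rule tendsto_norm_zero_cancel)
      have "filterlim (\<lambda>t. Re s * t) at_top at_top"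
        by (rule filterlim_tendsto_pos_mult_at_top[OF tendsto_const assms filterlim_ident])
      then have "filterlim (\<lambda>t. - (Re s * t)) at_bot at_top"
        by (simp add: filterlim_uminus_at_top)
      then have "((\<lambda>t. exp (- (Re s * t)) / norm s) \<longlongrightarrow> 0 / norm s) at_top"
        using s by (intro tendsto_divide tendsto_const filterlim_compose[OF exp_at_bot]) auto
      then show "((\<lambda>x. norm (- exp (- s * complex_of_real x) / s)) \<longlongrightarrow> 0) at_top"
        by (simp add: norm_divide)
    qed
  qed (use 1 in \<open>auto intro!: continuous_intros simp: einterval_eq_Ici\<close>)
  then show "(LINT t:{c<..}|lborel. exp (- s * of_real t)) = exp (- s * of_real c) / s"
    by (simp add: interval_lebesgue_integral_def)
qed

text \<open>The tail for the norm of the integrand, from which absolute integrability in Fubini's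
  theorem follows.\<close>

lemma exp_tail_real:
  assumes "(\<sigma>::real) > 0"
  shows "(LINT t:{c<..}|lborel. exp (- \<sigma> * t)) = exp (- \<sigma> * c) / \<sigma>"
proof -
  have "complex_of_real (LINT t:{c<..}|lborel. exp (- \<sigma> * t)) =
      (LINT t:{c<..}|lborel. complex_of_real (exp (- \<sigma> * t)))"
    by (rule set_integral_complex_of_real[symmetric])
  also have "\<dots> = (LINT t:{c<..}|lborel. exp (- of_real \<sigma> * of_real t))"
    by (simp flip: exp_of_real)
  also have "\<dots> = of_real (exp (- \<sigma> * c) / \<sigma>)"
    using exp_tail(2)[of "of_real \<sigma>" c] assms by (simp flip: exp_of_real)
  finally show ?thesis by (simp only: of_real_eq_iff)
qed

text \<open>Writing the cut-off at \<open>t\<close> as a conditional inside an integral over the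
  whole line keeps the integrand jointly measurable in both times, as measurability in
  \<open>t\<close> and Fubini's theorem require.\<close>

definition primitive :: "(real \<Rightarrow> complex) \<Rightarrow> real \<Rightarrow> complex" where
  "primitive v t = (LINT \<tau>|lborel. (if \<tau> < t then indicator {0..} \<tau> *\<^sub>R v \<tau> else 0))"

lemma csignal_primitive:
  assumes "csignal v"
  shows "csignal (primitive v)"
proof -
  obtain M a where b: "M \<ge> 0" "a \<ge> 0" "\<And>t. t \<ge> 0 \<Longrightarrow> norm (v t) \<le> M * exp (a * t)"
    using csignal_bound[OF assms] by metis
  define v0 where "v0 = (\<lambda>t. indicator {0..} t *\<^sub>R v t)"
  have v0[measurable]: "v0 \<in> borel_measurable borel"
    using assms unfolding csignal_def v0_def by simp
  have p: "primitive v = (\<lambda>t. LINT \<tau>|lborel. (if \<tau> < t then v0 \<tau> else 0))"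
    by (rule ext) (simp only: primitive_def v0_def)
  have [measurable]: "primitive v \<in> borel_measurable borel"
    unfolding p by measurable
  have "norm (primitive v t) \<le> M * exp ((a + 1) * t)" if t: "t \<ge> 0" for t
  proof -
    have "norm (primitive v t) \<le> (LINT \<tau>|lborel. norm (if \<tau> < t then v0 \<tau> else 0))"
      unfolding p by (rule integral_norm_bound)
    also have "\<dots> \<le> (LINT \<tau>|lborel. indicator {0..t} \<tau> *\<^sub>R (M * exp (a * t)))"
    proof (rule integral_mono')
      fix \<tau>
      have "M * exp (a * \<tau>) \<le> M * exp (a * t)" if "\<tau> < t"
        using b that by (intro mult_left_mono) (auto intro: mult_left_mono)
      then show "norm (if \<tau> < t then v0 \<tau> else 0) \<le> indicator {0..t} \<tau> *\<^sub>R (M * exp (a * t))"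
        using b(1) b(3)[of \<tau>] by (auto simp: v0_def indicator_def)
    qed (use b t in \<open>auto intro!: integrable_mult_left integrable_real_indicator\<close>)
    also have "\<dots> = t * (M * exp (a * t))" using t by simp
    \<comment> \<open>The length \<open>t\<close> of the interval is absorbed by
      \<open>exp t\<close>, which raises the growth rate from \<open>a\<close> to
      \<open>a + 1\<close>.\<close>
    also have "\<dots> \<le> exp t * (M * exp (a * t))"
      using b exp_ge_add_one_self[of t] by (intro mult_right_mono) (auto simp del: exp_ge_add_one_self)
    also have "\<dots> = M * exp ((a + 1) * t)" by (simp add: exp_add algebra_simps)
    finally show ?thesis .
  qed
  moreover have "(\<lambda>t. indicator {0..} t *\<^sub>R primitive v t) \<in> borel_measurable lborel"
    by measurable
  ultimately show ?thesis unfolding csignal_def by blast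
qed

text \<open>The order of integration over \<open>0 \<le> \<tau> < t\<close> is swapped; the inner
  integral over \<open>t > \<tau>\<close> is then the tail \<open>exp (- s \<tau>) / s\<close>.
  Absolute integrability reduces to that of the integrand of \<open>claplace v s\<close>.\<close>

lemma claplace_primitive:
  assumes "csignal v"
  shows "\<forall>\<^sub>F s in rhp. claplace (primitive v) s = claplace v s / s"
  using csignal_integrable[OF assms] eventually_rhp_gt[of 0]
proof eventually_elim
  case (elim s)
  define v0 where "v0 = (\<lambda>t. indicator {0..} t *\<^sub>R v t)"
  have v0[measurable]: "v0 \<in> borel_measurable borel"
    using assms unfolding csignal_def v0_def by simp
  define f where "f = (\<lambda>\<tau> t. if \<tau> < t then exp (- s * of_real t) * v0 \<tau> else 0)"
  have f_eq: "f \<tau> t = v0 \<tau> * (indicator {\<tau><..} t *\<^sub>R exp (- s * of_real t))" for \<tau> t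
    by (simp add: f_def)
  have nf_eq: "norm (f \<tau> t) = norm (v0 \<tau>) * (indicator {\<tau><..} t *\<^sub>R exp (- Re s * t))" for \<tau> t
    by (simp add: f_def norm_mult)
  have f1: "integrable lborel (f \<tau>)" for \<tau>
    unfolding f_eq[abs_def] using exp_tail(1)[OF elim(2), of \<tau>] 
    by (intro integrable_mult_right) (simp add: set_integrable_def)
  have i: "integrable (lborel \<Otimes>\<^sub>M lborel) (case_prod f)"
  proof (rule lborel_pair.Fubini_integrable)
    show "case_prod f \<in> borel_measurable (lborel \<Otimes>\<^sub>M lborel)"
      unfolding f_def by measurable
    have "(LINT t|lborel. norm (f \<tau> t)) = norm (exp (- s * of_real \<tau>) * v0 \<tau>) / Re s" for \<tau>
      unfolding nf_eq using exp_tail_real[OF elim(2), of \<tau>]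
      by (simp add: set_lebesgue_integral_def norm_mult)
    moreover have "integrable lborel (\<lambda>\<tau>. norm (exp (- s * of_real \<tau>) * v0 \<tau>) / Re s)"
    proof (intro integrable_divide integrable_norm)
      show "integrable lborel (\<lambda>\<tau>. exp (- s * of_real \<tau>) * v0 \<tau>)"
        using elim(1) unfolding set_integrable_def v0_def by simp
    qed
    ultimately show "integrable lborel (\<lambda>\<tau>. LINT t|lborel. norm (case_prod f (\<tau>, t)))" by simp
  qed (use f1 in simp)
  have "claplace (primitive v) s = (LINT t|lborel. LINT \<tau>|lborel. f \<tau> t)"
    unfolding claplace_def set_lebesgue_integral_def
  proof (rule Bochner_Integration.integral_cong[OF refl])
    fix t
    have "indicator {0..} t *\<^sub>R (exp (- s * of_real t) * primitive v t) =
        (LINT \<tau>|lborel. (indicator {0..} t * exp (- s * of_real t)) * (if \<tau> < t then v0 \<tau> else 0))"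
      unfolding primitive_def v0_def by (cases "t \<ge> 0") simp_all
    \<comment> \<open>\<open>f\<close> carries no cut-off at \<open>t \<ge> 0\<close>: for
      \<open>t < 0\<close> every \<open>\<tau> < t\<close> is negative, where \<open>v0\<close> is
      \<open>0\<close>.\<close>
    also have "\<dots> = (LINT \<tau>|lborel. f \<tau> t)"
      by (rule Bochner_Integration.integral_cong[OF refl]) (auto simp: f_def v0_def indicator_def)
    finally show "indicator {0..} t *\<^sub>R (exp (- s * of_real t) * primitive v t) =
      (LINT \<tau>|lborel. f \<tau> t)" .
  qed
  also have "\<dots> = (LINT \<tau>|lborel. LINT t|lborel. f \<tau> t)"
    by (rule lborel_pair.Fubini_integral[OF i])
  also have "\<dots> = (LINT \<tau>|lborel. (exp (- s * of_real \<tau>) * v0 \<tau>) / s)"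
  proof (rule Bochner_Integration.integral_cong[OF refl])
    fix \<tau>
    have "(LINT t|lborel. f \<tau> t) = v0 \<tau> * (LINT t|lborel. indicator {\<tau><..} t *\<^sub>R exp (- s * of_real t))"
      unfolding f_eq by (rule integral_mult_right_zero)
    then show "(LINT t|lborel. f \<tau> t) = (exp (- s * of_real \<tau>) * v0 \<tau>) / s"
      using exp_tail(2)[OF elim(2), of \<tau>] by (simp add: set_lebesgue_integral_def)
  qed
  also have "\<dots> = claplace v s / s"
    by (simp add: claplace_def set_lebesgue_integral_def v0_def)
  finally show ?case .
qed

subsection \<open>Realizability of proper rational functions\<close>

definition crealizable :: "(complex \<Rightarrow> complex) \<Rightarrow> bool" where
  "crealizable T \<longleftrightarrow>
     (\<forall>v. csignal v \<longrightarrow> (\<exists>w. csignal w \<and> (\<forall>\<^sub>F s in rhp. claplace w s = T s * claplace v s)))"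

lemma crealizable_cong:
  assumes "crealizable T" "\<forall>\<^sub>F s in rhp. T s = T' s"
  shows "crealizable T'"
  unfolding crealizable_def
proof (intro allI impI)
  fix v assume "csignal v"
  then obtain w where "csignal w" "\<forall>\<^sub>F s in rhp. claplace w s = T s * claplace v s"
    using assms unfolding crealizable_def by blast
  moreover from this(2) assms(2) have "\<forall>\<^sub>F s in rhp. claplace w s = T' s * claplace v s"
    by eventually_elim simp
  ultimately show "\<exists>w. csignal w \<and> (\<forall>\<^sub>F s in rhp. claplace w s = T' s * claplace v s)" by blast
qed

lemma crealizable_const: "crealizable (\<lambda>_. c)"
  unfolding crealizable_def
  by (auto intro!: exI[of _ "\<lambda>t. c * _ t"] csignal_mult csignal_const simp: claplace_cmult)

lemma crealizable_add:
  assumes "crealizable T" "crealizable T'"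
  shows "crealizable (\<lambda>s. T s + T' s)"
  unfolding crealizable_def
proof (intro allI impI)
  fix v assume v: "csignal v"
  obtain w w' where w: "csignal w" "\<forall>\<^sub>F s in rhp. claplace w s = T s * claplace v s"
    "csignal w'" "\<forall>\<^sub>F s in rhp. claplace w' s = T' s * claplace v s"
    using assms v unfolding crealizable_def by metis
  from w(2,4) claplace_add[OF w(1,3)]
  have "\<forall>\<^sub>F s in rhp. claplace (\<lambda>t. w t + w' t) s = (T s + T' s) * claplace v s"
    by eventually_elim (simp add: algebra_simps)
  with csignal_add[OF w(1,3)]
  show "\<exists>w. csignal w \<and> (\<forall>\<^sub>F s in rhp. claplace w s = (T s + T' s) * claplace v s)" by blast
qed

lemma crealizable_mult:
  assumes "crealizable T" "crealizable T'"
  shows "crealizable (\<lambda>s. T s * T' s)"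
  unfolding crealizable_def
proof (intro allI impI)
  fix v assume v: "csignal v"
  obtain w where w: "csignal w" "\<forall>\<^sub>F s in rhp. claplace w s = T' s * claplace v s"
    using assms(2) v unfolding crealizable_def by metis
  obtain w' where w': "csignal w'" "\<forall>\<^sub>F s in rhp. claplace w' s = T s * claplace w s"
    using assms(1) w unfolding crealizable_def by metis
  from w(2) w'(2) have "\<forall>\<^sub>F s in rhp. claplace w' s = (T s * T' s) * claplace v s"
    by eventually_elim simp
  with w'(1)
  show "\<exists>w. csignal w \<and> (\<forall>\<^sub>F s in rhp. claplace w s = (T s * T' s) * claplace v s)" by blast
qed

lemma eventually_rhp_shift:
  assumes "eventually P rhp" shows "\<forall>\<^sub>F s in rhp. P (s - a)"
proof -
  obtain \<sigma> where "\<forall>s. Re s > \<sigma> \<longrightarrow> P s" using assms unfolding eventually_rhp by blast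
  then show ?thesis unfolding eventually_rhp by (intro exI[of _ "\<sigma> + Re a"]) auto
qed

text \<open>\<open>w\<close> is the variation-of-constants formula for \<open>w' = a w + v\<close>
  with \<open>w 0 = 0\<close>. Exponential weights shift the argument of the transform, so the
  factor \<open>1 / s\<close> of the primitive appears at \<open>s - a\<close>.\<close>

lemma crealizable_pole: "crealizable (\<lambda>s. 1 / (s - a))"
  unfolding crealizable_def
proof (intro allI impI)
  fix v assume v: "csignal v"
  define x where "x = (\<lambda>t. exp (- a * of_real t) * v t)"
  have x: "csignal x" unfolding x_def by (intro csignal_mult csignal_exp v)
  define w where "w = (\<lambda>t. exp (a * of_real t) * primitive x t)"
  have "csignal w" unfolding w_def by (intro csignal_mult csignal_exp csignal_primitive x)
  moreover have "\<forall>\<^sub>F s in rhp. claplace w s = 1 / (s - a) * claplace v s"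
    using eventually_rhp_shift[OF claplace_primitive[OF x], of a]
  proof eventually_elim
    case (elim s)
    moreover have "claplace x (s - a) = claplace v s" unfolding x_def claplace_exp_mult by simp
    ultimately show ?case by (simp add: w_def claplace_exp_mult)
  qed
  ultimately show "\<exists>w. csignal w \<and> (\<forall>\<^sub>F s in rhp. claplace w s = 1 / (s - a) * claplace v s)"
    by blast
qed

text \<open>A root \<open>a\<close> of \<open>q = (s - a) q'\<close> is split off by
  \<open>p / q = p' / q' + (1 / (s - a)) (poly p a / q')\<close>, with \<open>p'\<close> the
  quotient of \<open>p\<close> by \<open>s - a\<close>. Both quotients over \<open>q'\<close> are
  proper again, and multiple roots call for no partial fractions.\<close>

lemma crealizable_proper:
  fixes p q :: "complex poly"
  assumes "q \<noteq> 0" "degree p \<le> degree q"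
  shows "crealizable (\<lambda>s. poly p s / poly q s)"
  using assms
proof (induction "degree q" arbitrary: p q)
  case 0
  then obtain c d where "p = [:c:]" "q = [:d:]" by (metis degree_eq_zeroE le_zero_eq)
  then show ?case by (simp add: crealizable_const)
next
  case (Suc n)
  obtain a where "poly q a = 0"
    using fundamental_theorem_of_algebra[of q] Suc.hyps(2) by (auto simp: constant_degree)
  then obtain q' where q: "q = [:-a, 1:] * q'" by (auto simp: poly_eq_0_iff_dvd)
  then have q': "q' \<noteq> 0" using Suc.prems by auto
  have "degree q = Suc (degree q')" unfolding q using q' by (subst degree_mult_eq) auto
  with q' Suc.hyps(2) have q': "q' \<noteq> 0" "degree q' = n" by auto
  define p' where "p' = synthetic_div p a"
  have p: "p = [:-a, 1:] * p' + [:poly p a:]"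
    using synthetic_div_correct'[of a p] by (simp only: p'_def)
  have dp': "degree p' \<le> n" unfolding p'_def degree_synthetic_div using Suc by linarith
  have 1: "crealizable (\<lambda>s. poly p' s / poly q' s)" using Suc.hyps(1)[of q' p'] q' dp' by simp
  have 2: "crealizable (\<lambda>s. poly [:poly p a:] s / poly q' s)"
    using Suc.hyps(1)[of q' "[:poly p a:]"] q' by simp
  have "crealizable (\<lambda>s. poly p' s / poly q' s + 1 / (s - a) * (poly [:poly p a:] s / poly q' s))"
    by (intro crealizable_add crealizable_mult crealizable_pole 1 2)
  moreover have "\<forall>\<^sub>F s in rhp. poly p' s / poly q' s + 1 / (s - a) * (poly [:poly p a:] s / poly q' s) =
     poly p s / poly q s"
    using eventually_rhp_gt[of "Re a"]
  proof eventually_elim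
    case (elim s)
    then have "s - a \<noteq> 0" by auto
    then show ?case by (subst (2) p) (simp add: q divide_simps, simp add: algebra_simps)
  qed
  ultimately show ?case by (rule crealizable_cong)
qed

subsection \<open>Real signals and blocks\<close>

lemma signal_csignal: "signal x \<longleftrightarrow> csignal (\<lambda>t. of_real (x t))"
proof -
  have "(\<lambda>t. indicator {0..} t *\<^sub>R x t) \<in> borel_measurable borel \<longleftrightarrow>
      (\<lambda>t. indicator {0..} t *\<^sub>R complex_of_real (x t)) \<in> borel_measurable borel" (is "?l \<longleftrightarrow> ?r")
  proof
    assume ?l
    then have "(\<lambda>t. complex_of_real (indicator {0..} t *\<^sub>R x t)) \<in> borel_measurable borel"
      by (intro borel_measurable_continuous_on[of of_real] continuous_intros)
    then show ?r by (simp add: scaleR_conv_of_real)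
  next
    assume ?r
    then have "(\<lambda>t. Re (indicator {0..} t *\<^sub>R complex_of_real (x t))) \<in> borel_measurable borel"
      by measurable
    then show ?l by simp
  qed
  then show ?thesis by (simp add: signal_def csignal_def set_borel_measurable_def)
qed

lemma laplace_claplace: "laplace x s = claplace (\<lambda>t. of_real (x t)) s"
  by (simp add: laplace_def claplace_def)

lemma csignal_cong:
  assumes "csignal v" "\<And>t. t \<ge> 0 \<Longrightarrow> v t = w t"
  shows "csignal w"
proof -
  have "(\<lambda>t. indicator {0..} t *\<^sub>R v t) = (\<lambda>t. indicator {0..} t *\<^sub>R w t)"
    using assms(2) by (auto simp: fun_eq_iff indicator_def)
  then show ?thesis using assms unfolding csignal_def by simp
qed

lemma signal_cong:
  assumes "signal x" "\<And>t. t \<ge> 0 \<Longrightarrow> x t = y t"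
  shows "signal y"
  using assms unfolding signal_csignal by (elim csignal_cong) simp

lemma laplace_cong:
  assumes "\<And>t. t \<ge> 0 \<Longrightarrow> x t = y t"
  shows "laplace x = laplace y"
  unfolding laplace_def
  by (rule ext) (intro set_lebesgue_integral_cong, auto simp: assms)

lemma signal_const [intro]: "signal (\<lambda>_. c)"
  unfolding signal_csignal by (rule csignal_const)

lemma signal_add [intro]: "signal x \<Longrightarrow> signal y \<Longrightarrow> signal (\<lambda>t. x t + y t)"
  unfolding signal_csignal by (simp add: csignal_add)

lemma signal_mult [intro]: "signal x \<Longrightarrow> signal y \<Longrightarrow> signal (\<lambda>t. x t * y t)"
  unfolding signal_csignal by (simp add: csignal_mult)

lemma signal_cmult: "signal x \<Longrightarrow> signal (\<lambda>t. c * x t)"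
  by (intro signal_mult signal_const)

lemma signal_minus [intro]: "signal x \<Longrightarrow> signal (\<lambda>t. - x t)"
  using signal_cmult[of x "-1"] by simp

lemma signal_diff [intro]: "signal x \<Longrightarrow> signal y \<Longrightarrow> signal (\<lambda>t. x t - y t)"
  using signal_add[of x "\<lambda>t. - y t"] signal_minus[of y] by simp

lemma signal_sum [intro]: "(\<And>k. k \<in> A \<Longrightarrow> signal (x k)) \<Longrightarrow> signal (\<lambda>t. \<Sum>k\<in>A. x k t)"
  by (induction A rule: infinite_finite_induct) auto

lemma laplace_cmult: "laplace (\<lambda>t. c * x t) s = of_real c * laplace x s"
  unfolding laplace_claplace by (simp add: claplace_cmult)

lemma laplace_minus: "laplace (\<lambda>t. - x t) s = - laplace x s"
  using laplace_cmult[of "-1" x s] by simp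

lemma laplace_add:
  assumes "signal x" "signal y"
  shows "\<forall>\<^sub>F s in rhp. laplace (\<lambda>t. x t + y t) s = laplace x s + laplace y s"
  using assms unfolding signal_csignal laplace_claplace by (simp add: claplace_add)

lemma laplace_diff:
  assumes "signal x" "signal y"
  shows "\<forall>\<^sub>F s in rhp. laplace (\<lambda>t. x t - y t) s = laplace x s - laplace y s"
  using laplace_add[OF assms(1) signal_minus[OF assms(2)]] by (simp add: laplace_minus)

lemma laplace_sum:
  assumes "finite A" "\<And>k. k \<in> A \<Longrightarrow> signal (x k)"
  shows "\<forall>\<^sub>F s in rhp. laplace (\<lambda>t. \<Sum>k\<in>A. x k t) s = (\<Sum>k\<in>A. laplace (x k) s)"
  using assms
proof (induction A)
  case empty
  then show ?case by (simp add: laplace_def)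
next
  case (insert k A)
  then have "\<forall>\<^sub>F s in rhp. laplace (\<lambda>t. \<Sum>k\<in>A. x k t) s = (\<Sum>k\<in>A. laplace (x k) s)" by simp
  moreover have "\<forall>\<^sub>F s in rhp. laplace (\<lambda>t. x k t + (\<Sum>k\<in>A. x k t)) s =
      laplace (x k) s + laplace (\<lambda>t. \<Sum>k\<in>A. x k t) s"
    using insert.prems by (intro laplace_add signal_sum) auto
  ultimately show ?case
    unfolding sum.insert[OF insert.hyps] by eventually_elim simp
qed

text \<open>The unit step is the test input: its transform has no zero for \<open>Re s > 0\<close>,
  so it cancels when two transfer functions are compared.\<close>

lemma laplace_one: "Re s > 0 \<Longrightarrow> laplace (\<lambda>_. 1) s = 1 / s"
proof -
  assume s: "Re s > 0"
  have "laplace (\<lambda>_. 1) s = (LINT t:{0<..}|lborel. exp (- s * of_real t))"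
    unfolding laplace_def set_lebesgue_integral_def
  proof (rule integral_cong_AE)
    show "AE t in lborel. indicator {0..} t *\<^sub>R (exp (- s * of_real t) * of_real 1) =
        indicator {0<..} t *\<^sub>R exp (- s * of_real t)"
      using AE_lborel_singleton[of 0] by eventually_elim (auto simp: indicator_def)
  qed auto
  then show ?thesis using exp_tail(2)[OF s, of 0] by simp
qed

lemma block_iff:
  "block T u y \<longleftrightarrow> signal u \<and> signal y \<and> (\<forall>\<^sub>F s in rhp. laplace y s = T s * laplace u s)"
  by (simp add: block_def eventually_rhp)

lemma block_cong:
  assumes "\<forall>\<^sub>F s in rhp. T s = T' s"
  shows "block T u y \<longleftrightarrow> block T' u y"
  unfolding block_iff
  by (intro conj_cong refl eventually_subst) (use assms in \<open>eventually_elim, simp\<close>)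

text \<open>The system equations constrain signals only for \<open>t \<ge> 0\<close>, so block
  relations have to survive changes at negative times.\<close>

lemma block_cong_signals:
  assumes "block T u y" "\<And>t. t \<ge> 0 \<Longrightarrow> u t = u' t" "\<And>t. t \<ge> 0 \<Longrightarrow> y t = y' t"
  shows "block T u' y'"
  using assms signal_cong[of u u'] signal_cong[of y y'] laplace_cong[of u u'] laplace_cong[of y y']
  unfolding block_iff by simp

section \<open>Real polynomials at complex arguments, conjugation and real outputs\<close>

abbreviation cpoly :: "real poly \<Rightarrow> complex poly" where
  "cpoly \<equiv> map_poly of_real"

lemma degree_cpoly: "degree (cpoly p) = degree p"
  by (rule degree_map_poly) simp

lemma cpoly_eq_0: "cpoly p = 0 \<longleftrightarrow> p = 0"
  by (rule map_poly_eq_0_iff) auto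

lemma cpoly_add: "cpoly (p + q) = cpoly p + cpoly q"
  by (rule poly_eqI) (simp add: coeff_map_poly)

lemma cpoly_mult: "cpoly (p * q) = cpoly p * cpoly q"
  by (rule poly_eqI) (simp add: coeff_map_poly coeff_mult)

lemma poly_cpoly_cnj: "poly (cpoly p) (cnj s) = cnj (poly (cpoly p) s)"
  by (simp add: poly_altdef degree_cpoly coeff_map_poly)

lemma claplace_cnj: "claplace (\<lambda>t. cnj (v t)) s = cnj (claplace v (cnj s))"
proof -
  have "claplace (\<lambda>t. cnj (v t)) s = (LINT t|lborel. cnj (indicator {0..} t *\<^sub>R (exp (- cnj s * of_real t) * v t)))"
    unfolding claplace_def set_lebesgue_integral_def
    by (simp add: exp_cnj del: Bochner_Integration.integral_cnj)
  also have "\<dots> = cnj (claplace v (cnj s))"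
    unfolding claplace_def set_lebesgue_integral_def by (rule Bochner_Integration.integral_cnj)
  finally show ?thesis .
qed

lemma csignal_cnj: "csignal v \<Longrightarrow> csignal (\<lambda>t. cnj (v t))"
proof -
  assume v: "csignal v"
  then have "(\<lambda>t. cnj (indicator {0..} t *\<^sub>R v t)) \<in> borel_measurable lborel"
    unfolding csignal_def by (intro borel_measurable_continuous_on[of cnj] continuous_intros) auto
  then show ?thesis using v unfolding csignal_def by simp
qed

lemma eventually_rhp_cnj: "eventually P rhp \<Longrightarrow> \<forall>\<^sub>F s in rhp. P (cnj s)"
  unfolding eventually_rhp by (metis complex_cnj(1) complex.exhaust_sel complex.sel(1))

text \<open>The complex output \<open>w\<close> and its conjugate have the same transform, so \<open>Re w\<close> is an output.\<close>

lemma proper_real_rational_realizable: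
  assumes "proper_real_rational T" "signal u"
  shows "\<exists>y. block T u y"
proof -
  obtain p q :: "real poly" where pq: "q \<noteq> 0" "degree p \<le> degree q"
    and T: "T = (\<lambda>s. poly (cpoly p) s / poly (cpoly q) s)"
    using assms(1) unfolding proper_real_rational_def by auto
  have "crealizable T"
    unfolding T by (rule crealizable_proper) (use pq in \<open>auto simp: cpoly_eq_0 degree_cpoly\<close>)
  then obtain w where w: "csignal w" "\<forall>\<^sub>F s in rhp. claplace w s = T s * laplace u s"
    using assms(2) unfolding crealizable_def signal_csignal laplace_claplace by blast
  define y where "y = (\<lambda>t. Re (w t))"
  have y: "(\<lambda>t. complex_of_real (y t)) = (\<lambda>t. 1 / 2 * (w t + cnj (w t)))"
    by (simp add: y_def fun_eq_iff complex_add_cnj)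
  have "signal y"
    unfolding signal_csignal y by (intro csignal_mult csignal_const csignal_add csignal_cnj w)
  moreover have "\<forall>\<^sub>F s in rhp. laplace y s = T s * laplace u s"
    using w(2) eventually_rhp_cnj[OF w(2)] claplace_add[OF w(1) csignal_cnj[OF w(1)]]
  proof eventually_elim
    case (elim s)
    have "cnj (laplace u (cnj s)) = laplace u s"
      unfolding laplace_claplace claplace_cnj[symmetric] by simp
    moreover have "cnj (T (cnj s)) = T s" by (simp add: T poly_cpoly_cnj)
    ultimately have "claplace (\<lambda>t. cnj (w t)) s = T s * laplace u s"
      using elim(2) by (simp add: claplace_cnj)
    with elim(1,3) show ?case unfolding laplace_claplace[of y] y claplace_cmult by simp
  qed
  ultimately show ?thesis using assms(2) unfolding block_iff by blast
qed

subsection \<open>Rational functions up to finitely many points\<close>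

text \<open>Since \<open>x / 0 = 0\<close>, a closed-loop expression agrees with a quotient of
  polynomials only away from the poles of its parts. Allowing finitely many exceptions makes the
  class closed under the field operations.\<close>

definition ratf :: "(complex \<Rightarrow> complex) \<Rightarrow> bool" where
  "ratf F \<longleftrightarrow> (\<exists>T. real_rational T \<and> (\<forall>\<^sub>F s in cofinite. F s = T s))"

lemma ratfI:
  assumes "q \<noteq> 0" "\<forall>\<^sub>F s in cofinite. F s = poly (cpoly p) s / poly (cpoly q) s"
  shows "ratf F"
  unfolding ratf_def real_rational_def
  by (intro exI[of _ "\<lambda>s. poly (cpoly p) s / poly (cpoly q) s"] exI[of _ p] exI[of _ q] conjI)
    (use assms in simp_all)

lemma ratfE:
  assumes "ratf F"
  obtains p q where "q \<noteq> 0" "\<forall>\<^sub>F s in cofinite. F s = poly (cpoly p) s / poly (cpoly q) s"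
proof -
  obtain T p q where "q \<noteq> 0" "\<forall>s. T s = poly (cpoly p) s / poly (cpoly q) s"
    "\<forall>\<^sub>F s in cofinite. F s = T s"
    using assms unfolding ratf_def real_rational_def by blast
  then show thesis by (intro that[of q p]) simp_all
qed

text \<open>With the next two inclusions, what holds off a finite set can be read at infinity, on a
  right half-plane and near any point, in particular near \<open>0\<close>.\<close>

lemma at_infinity_le_cofinite: "(at_infinity :: complex filter) \<le> cofinite"
proof (rule filter_leI)
  fix P :: "complex \<Rightarrow> bool" assume "eventually P cofinite"
  then have "bounded {x. \<not> P x}" unfolding eventually_cofinite by (rule finite_imp_bounded)
  then obtain B where "\<forall>x\<in>{x. \<not> P x}. norm x \<le> B" unfolding bounded_iff by blast
  then have "norm x \<ge> B + 1 \<Longrightarrow> P x" for x by force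
  then show "eventually P at_infinity" unfolding eventually_at_infinity by blast
qed

lemma rhp_le_at_infinity: "rhp \<le> at_infinity"
proof (rule filter_leI)
  fix P :: "complex \<Rightarrow> bool" assume "eventually P at_infinity"
  then obtain B where B: "\<forall>x. norm x \<ge> B \<longrightarrow> P x" unfolding eventually_at_infinity by blast
  have "P x" if "Re x > B" for x using that B complex_Re_le_cmod[of x] by (meson less_le_trans less_imp_le)
  then show "eventually P rhp" unfolding eventually_rhp by blast
qed

lemma at_le_cofinite: "at (a::complex) \<le> cofinite"
proof (rule filter_leI)
  fix P :: "complex \<Rightarrow> bool" assume "eventually P cofinite"
  then have "finite {x. \<not> P x}" unfolding eventually_cofinite .
  then have "open (- ({x. \<not> P x} - {a}))" by (intro open_Compl finite_imp_closed) auto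
  then show "eventually P (at a)" unfolding eventually_at_topological by blast
qed

lemma eventually_cofinite_rhp: "eventually P cofinite \<Longrightarrow> eventually P rhp"
  using at_infinity_le_cofinite rhp_le_at_infinity by (meson filter_leD)

lemma rhp_neq_bot: "rhp \<noteq> bot"
proof
  assume "rhp = bot"
  then have "eventually (\<lambda>_. False) rhp" by simp
  then obtain \<sigma> where "\<And>s. \<not> (Re s > \<sigma>)" unfolding eventually_rhp by blast
  from this[of "of_real (\<sigma> + 1)"] show False by simp
qed

lemma poly_nonzero_cofinite: "p \<noteq> 0 \<Longrightarrow> \<forall>\<^sub>F s in cofinite. poly (p::complex poly) s \<noteq> 0"
  unfolding eventually_cofinite by (simp add: poly_roots_finite)

lemma poly_eq_0_rhp:
  assumes "\<forall>\<^sub>F s in rhp. poly (p::complex poly) s = 0" shows "p = 0"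
proof (rule ccontr)
  assume "p \<noteq> 0"
  from assms eventually_cofinite_rhp[OF poly_nonzero_cofinite[OF this]]
  have "\<forall>\<^sub>F s in rhp. False" by eventually_elim simp
  then show False using rhp_neq_bot by simp
qed

text \<open>Cleared of denominators, the identity says that a polynomial vanishes on a half-plane.
  It is then the zero polynomial, and the quotients agree off the zeros of the denominators.\<close>

lemma ratf_eq_cofinite:
  assumes "ratf F" "ratf H" "\<forall>\<^sub>F s in rhp. F s = H s"
  shows "\<forall>\<^sub>F s in cofinite. F s = H s"
proof -
  obtain p q where F: "q \<noteq> 0" "\<forall>\<^sub>F s in cofinite. F s = poly (cpoly p) s / poly (cpoly q) s"
    by (rule ratfE[OF assms(1)])
  obtain p' q' where H: "q' \<noteq> 0" "\<forall>\<^sub>F s in cofinite. H s = poly (cpoly p') s / poly (cpoly q') s"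
    by (rule ratfE[OF assms(2)])
  have nz: "\<forall>\<^sub>F s in cofinite. poly (cpoly q) s \<noteq> 0" "\<forall>\<^sub>F s in cofinite. poly (cpoly q') s \<noteq> 0"
    using F(1) H(1) by (auto intro!: poly_nonzero_cofinite simp: cpoly_eq_0)
  have "\<forall>\<^sub>F s in rhp. poly (cpoly p * cpoly q' - cpoly p' * cpoly q) s = 0"
    using assms(3) F(2)[THEN eventually_cofinite_rhp] H(2)[THEN eventually_cofinite_rhp]
      nz[THEN eventually_cofinite_rhp]
    by eventually_elim (simp add: field_simps)
  then have eq: "cpoly p * cpoly q' - cpoly p' * cpoly q = 0" by (rule poly_eq_0_rhp)
  have "poly (cpoly p) s * poly (cpoly q') s = poly (cpoly p') s * poly (cpoly q) s" for s
    using arg_cong[OF eq, of "\<lambda>p. poly p s"] by simp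
  then have "poly (cpoly q) s \<noteq> 0 \<Longrightarrow> poly (cpoly q') s \<noteq> 0 \<Longrightarrow>
      poly (cpoly p) s / poly (cpoly q) s = poly (cpoly p') s / poly (cpoly q') s" for s
    by (simp add: frac_eq_eq)
  note eq = this
  from F(2) H(2) nz show ?thesis
    by eventually_elim (simp add: eq)
qed

section \<open>Closure of rational functions under the field operations\<close>

lemma ratf_of_real: "ratf (\<lambda>_. of_real c)"
  by (rule ratfI[of 1 _ "[:c:]"]) (simp_all add: map_poly_pCons)

lemma ratf_ident: "ratf (\<lambda>s. s)"
  by (rule ratfI[of 1 _ "[:0, 1:]"]) (simp_all add: map_poly_pCons)

lemma ratf_add:
  assumes "ratf F" "ratf H" shows "ratf (\<lambda>s. F s + H s)"
proof -
  obtain p q where F: "q \<noteq> 0" "\<forall>\<^sub>F s in cofinite. F s = poly (cpoly p) s / poly (cpoly q) s"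
    by (rule ratfE[OF assms(1)])
  obtain p' q' where H: "q' \<noteq> 0" "\<forall>\<^sub>F s in cofinite. H s = poly (cpoly p') s / poly (cpoly q') s"
    by (rule ratfE[OF assms(2)])
  have nz: "\<forall>\<^sub>F s in cofinite. poly (cpoly q) s \<noteq> 0" "\<forall>\<^sub>F s in cofinite. poly (cpoly q') s \<noteq> 0"
    using F(1) H(1) by (auto intro!: poly_nonzero_cofinite simp: cpoly_eq_0)
  from F(2) H(2) nz have "\<forall>\<^sub>F s in cofinite. F s + H s =
      poly (cpoly (p * q' + p' * q)) s / poly (cpoly (q * q')) s"
    by eventually_elim (simp add: cpoly_add cpoly_mult add_frac_eq)
  then show ?thesis by (rule ratfI[rotated]) (use F(1) H(1) in simp)
qed

lemma ratf_mult:
  assumes "ratf F" "ratf H" shows "ratf (\<lambda>s. F s * H s)"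
proof -
  obtain p q where F: "q \<noteq> 0" "\<forall>\<^sub>F s in cofinite. F s = poly (cpoly p) s / poly (cpoly q) s"
    by (rule ratfE[OF assms(1)])
  obtain p' q' where H: "q' \<noteq> 0" "\<forall>\<^sub>F s in cofinite. H s = poly (cpoly p') s / poly (cpoly q') s"
    by (rule ratfE[OF assms(2)])
  from F(2) H(2) have "\<forall>\<^sub>F s in cofinite. F s * H s =
      poly (cpoly (p * p')) s / poly (cpoly (q * q')) s"
    by eventually_elim (simp add: cpoly_mult)
  then show ?thesis by (rule ratfI[rotated]) (use F(1) H(1) in simp)
qed

lemma ratf_inverse:
  assumes "ratf F" shows "ratf (\<lambda>s. inverse (F s))"
proof -
  obtain p q where F: "q \<noteq> 0" "\<forall>\<^sub>F s in cofinite. F s = poly (cpoly p) s / poly (cpoly q) s"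
    by (rule ratfE[OF assms(1)])
  show ?thesis
  proof (cases "p = 0")
    \<comment> \<open>Here \<open>F\<close> vanishes up to finitely many points, and so does its
      inverse because \<open>inverse 0 = 0\<close>.\<close>
    case True
    from F(2) have "\<forall>\<^sub>F s in cofinite. inverse (F s) = poly (cpoly 0) s / poly (cpoly 1) s"
      by eventually_elim (simp add: True)
    then show ?thesis by (rule ratfI[rotated]) simp
  next
    case False
    from F(2) have "\<forall>\<^sub>F s in cofinite. inverse (F s) = poly (cpoly q) s / poly (cpoly p) s"
      by eventually_elim simp
    then show ?thesis by (rule ratfI[OF False])
  qed
qed

lemma ratf_divide:
  assumes "ratf F" "ratf H" shows "ratf (\<lambda>s. F s / H s)"
  using ratf_mult[OF assms(1) ratf_inverse[OF assms(2)]] by (simp only: divide_inverse)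

lemma ratf_minus:
  assumes "ratf F" shows "ratf (\<lambda>s. - F s)"
  using ratf_mult[OF ratf_of_real[of "-1"] assms] by simp

lemma ratf_diff:
  assumes "ratf F" "ratf H" shows "ratf (\<lambda>s. F s - H s)"
  using ratf_add[OF assms(1) ratf_minus[OF assms(2)]] by simp

lemma ratf_power: "ratf F \<Longrightarrow> ratf (\<lambda>s. F s ^ n)"
  using ratf_of_real[of 1] by (induction n) (simp_all add: ratf_mult)

lemma ratf_1: "ratf (\<lambda>_. 1)" and ratf_of_nat: "ratf (\<lambda>_. of_nat n)" and ratf_numeral: "ratf (\<lambda>_. numeral k)"
  using ratf_of_real[of 1] ratf_of_real[of "of_nat n"] ratf_of_real[of "numeral k"] by simp_all

lemmas ratf_intros = ratf_of_real ratf_ident ratf_add ratf_mult ratf_divide ratf_minus ratf_diff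
  ratf_power ratf_1 ratf_of_nat ratf_numeral

lemma real_rational_ratf: "real_rational T \<Longrightarrow> ratf T"
  unfolding ratf_def by (auto intro!: exI[of _ T])

lemma proper_real_rational_ratf: "proper_real_rational T \<Longrightarrow> ratf T"
  by (rule real_rational_ratf) (unfold proper_real_rational_def real_rational_def, blast)

text \<open>Writing the limit with \<open>coeff p (degree q)\<close> covers both cases: it is the
  leading coefficient of \<open>p\<close> for equal degrees and \<open>0\<close> for smaller
  degree.\<close>

lemma poly_quotient_tendsto_at_infinity:
  fixes p q :: "complex poly"
  assumes "q \<noteq> 0" "degree p \<le> degree q"
  shows "((\<lambda>s. poly p s / poly q s) \<longlongrightarrow> coeff p (degree q) / lead_coeff q) at_infinity"
proof (cases "degree p = degree q")
  case True
  have "((\<lambda>s. (poly p s / s ^ degree p) / (poly q s / s ^ degree q)) \<longlongrightarrow> lead_coeff p / lead_coeff q) at_infinity"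
    using assms by (intro tendsto_divide[OF poly_divide_tendsto_aux poly_divide_tendsto_aux]) auto
  moreover have "(poly p s / s ^ degree p) / (poly q s / s ^ degree q) = poly p s / poly q s"
    if "1 \<le> norm s" for s
  proof -
    from that have "s \<noteq> 0" by auto
    then show ?thesis unfolding True by simp
  qed
  then have "\<forall>\<^sub>F s in at_infinity. (poly p s / s ^ degree p) / (poly q s / s ^ degree q) = poly p s / poly q s"
    by (rule eventually_at_infinityI)
  ultimately have "((\<lambda>s. poly p s / poly q s) \<longlongrightarrow> lead_coeff p / lead_coeff q) at_infinity"
    by (rule Lim_transform_eventually)
  then show ?thesis by (simp add: True)
next
  case False
  then show ?thesis using assms poly_divide_tendsto_0_at_infinity[of p q] by (simp add: coeff_eq_0)
qed

lemma proper_real_rational_tendsto: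
  assumes "proper_real_rational T" shows "\<exists>c. (T \<longlongrightarrow> c) at_infinity"
proof -
  obtain p q :: "real poly" where pq: "q \<noteq> 0" "degree p \<le> degree q"
    and T: "T = (\<lambda>s. poly (cpoly p) s / poly (cpoly q) s)"
    using assms(1) unfolding proper_real_rational_def by auto
  show ?thesis unfolding T
    by (rule exI, rule poly_quotient_tendsto_at_infinity) (use pq in \<open>auto simp: cpoly_eq_0 degree_cpoly\<close>)
qed

text \<open>A finite limit at infinity stands in for properness: limits of closed-loop expressions
  follow from limit rules, with no polynomial representation of them at hand.\<close>

lemma ratf_realizable:
  assumes "ratf F" "(F \<longlongrightarrow> c) at_infinity" "signal u"
  shows "\<exists>y. block F u y"
proof -
  obtain p q where F: "q \<noteq> 0" "\<forall>\<^sub>F s in cofinite. F s = poly (cpoly p) s / poly (cpoly q) s"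
    by (rule ratfE[OF assms(1)])
  define T where "T = (\<lambda>s. poly (cpoly p) s / poly (cpoly q) s)"
  have FT: "\<forall>\<^sub>F s in cofinite. F s = T s" using F(2) by (simp add: T_def)
  have "degree p \<le> degree q"
  proof (rule ccontr)
    assume *: "\<not> degree p \<le> degree q"
    \<comment> \<open>For an improper quotient \<open>q / p\<close> would tend to \<open>0\<close>
      and \<open>T\<close> to \<open>c\<close>, although their product is \<open>1\<close> up to
      finitely many points.\<close>
    have "((\<lambda>s. poly (cpoly q) s / poly (cpoly p) s) \<longlongrightarrow> 0) at_infinity"
      using * by (intro poly_divide_tendsto_0_at_infinity) (simp add: degree_cpoly)
    moreover have "(T \<longlongrightarrow> c) at_infinity"
      using assms(2) tendsto_cong filter_leD[OF at_infinity_le_cofinite FT] by blast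
    ultimately have "((\<lambda>s. (poly (cpoly q) s / poly (cpoly p) s) * T s) \<longlongrightarrow> 0 * c) at_infinity"
      by (rule tendsto_mult)
    moreover
    have "p \<noteq> 0" using * by auto
    then have "\<forall>\<^sub>F s in cofinite. poly (cpoly p) s \<noteq> 0" "\<forall>\<^sub>F s in cofinite. poly (cpoly q) s \<noteq> 0"
      using F(1) by (simp_all add: poly_nonzero_cofinite cpoly_eq_0)
    then have "\<forall>\<^sub>F s in cofinite. poly (cpoly q) s / poly (cpoly p) s * T s = 1"
      by eventually_elim (simp add: T_def)
    then have "\<forall>\<^sub>F s in at_infinity. poly (cpoly q) s / poly (cpoly p) s * T s = 1"
      by (rule filter_leD[OF at_infinity_le_cofinite])
    ultimately have "((\<lambda>_::complex. 1::complex) \<longlongrightarrow> 0 * c) at_infinity"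
      by (rule Lim_transform_eventually)
    then show False by (simp add: tendsto_const_iff trivial_limit_at_infinity)
  qed
  then have "proper_real_rational T"
    using F(1) unfolding proper_real_rational_def T_def by blast
  then obtain y where "block T u y" using proper_real_rational_realizable assms(3) by blast
  with block_cong[OF eventually_cofinite_rhp[OF FT]] show ?thesis by blast
qed

text \<open>The response to the unit step determines \<open>T\<close> on a half-plane, hence up to
  finitely many points. Questions about the transfer functions of a system reduce in this way to one
  explicit \<open>F\<close>.\<close>

lemma is_transfer_function_iff:
  assumes "ratf F"
    and "\<And>u. signal u \<Longrightarrow> \<exists>y. R u y"
    and "\<And>u y. signal u \<Longrightarrow> R u y \<Longrightarrow> block F u y"
  shows "is_transfer_function R T \<longleftrightarrow> real_rational T \<and> (\<forall>\<^sub>F s in cofinite. T s = F s)"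
proof
  assume T: "is_transfer_function R T"
  obtain y where y: "R (\<lambda>_. 1) y" using assms(2) by blast
  have "block T (\<lambda>_. 1) y" using T y unfolding is_transfer_function_def by blast
  moreover have "block F (\<lambda>_. 1) y" using assms(3) y by blast
  ultimately have "\<forall>\<^sub>F s in rhp. laplace y s = T s * laplace (\<lambda>_. 1) s"
    "\<forall>\<^sub>F s in rhp. laplace y s = F s * laplace (\<lambda>_. 1) s" unfolding block_iff by auto
  then have "\<forall>\<^sub>F s in rhp. T s = F s"
    using eventually_rhp_gt[of 0]
  proof eventually_elim
    case (elim s)
    then have "s \<noteq> 0" by auto
    with elim show ?case by (auto simp: laplace_one)
  qed
  moreover have "real_rational T" using T unfolding is_transfer_function_def by blast
  ultimately show "real_rational T \<and> (\<forall>\<^sub>F s in cofinite. T s = F s)"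
    using ratf_eq_cofinite real_rational_ratf assms(1) by blast
next
  assume T: "real_rational T \<and> (\<forall>\<^sub>F s in cofinite. T s = F s)"
  then have "block T u y \<longleftrightarrow> block F u y" for u y
    by (intro block_cong eventually_cofinite_rhp) blast
  with T assms show "is_transfer_function R T" unfolding is_transfer_function_def by auto
qed

subsection \<open>Closed loops\<close>

text \<open>\<open>z'\<close> is the response of \<open>K2\<close> to \<open>r\<close> without
  feedback. Driving \<open>H / (1 + H K2)\<close> by \<open>w + z'\<close> yields the current of the
  closed loop, and the true \<open>z\<close> is then the response to \<open>r - i\<close>.\<close>

lemma inner_loop_exists:
  assumes "ratf K1" "(K1 \<longlongrightarrow> k1) at_infinity" "ratf K2" "(K2 \<longlongrightarrow> k2) at_infinity"
    and "ratf H" "(H \<longlongrightarrow> 0) at_infinity" and e: "signal e" and r: "signal r"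
  shows "\<exists>w z i. block K1 e w \<and> block K2 (\<lambda>t. r t - i t) z \<and> block H (\<lambda>t. w t + z t) i"
proof -
  obtain w where w: "block K1 e w" using ratf_realizable[OF assms(1,2) e] by blast
  obtain z' where z': "block K2 r z'" using ratf_realizable[OF assms(3,4) r] by blast
  have wz: "signal (\<lambda>t. w t + z' t)" using w z' unfolding block_iff by blast
  have lim: "((\<lambda>s. 1 + H s * K2 s) \<longlongrightarrow> 1) at_infinity"
    using tendsto_add[OF tendsto_const[of 1] tendsto_mult[OF assms(6,4)]] by simp
  then have "\<forall>\<^sub>F s in at_infinity. 1 + H s * K2 s \<noteq> 0"
    by (rule tendsto_imp_eventually_ne) simp
  then have nz: "\<forall>\<^sub>F s in rhp. 1 + H s * K2 s \<noteq> 0"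
    by (rule filter_leD[OF rhp_le_at_infinity])
  have "((\<lambda>s. H s / (1 + H s * K2 s)) \<longlongrightarrow> 0) at_infinity"
    using tendsto_divide[OF assms(6) lim] by simp
  moreover have "ratf (\<lambda>s. H s / (1 + H s * K2 s))" by (intro ratf_intros assms)
  ultimately obtain i where i: "block (\<lambda>s. H s / (1 + H s * K2 s)) (\<lambda>t. w t + z' t) i"
    using ratf_realizable[OF _ _ wz] by blast
  have ri: "signal (\<lambda>t. r t - i t)" using r i unfolding block_iff by blast
  obtain z where z: "block K2 (\<lambda>t. r t - i t) z" using ratf_realizable[OF assms(3,4) ri] by blast
  have sw: "signal w" and sz: "signal z" and sz': "signal z'" and si: "signal i"
    using w z z' i unfolding block_iff by auto
  have "\<forall>\<^sub>F s in rhp. laplace z' s = K2 s * laplace r s"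
    "\<forall>\<^sub>F s in rhp. laplace z s = K2 s * laplace (\<lambda>t. r t - i t) s"
    "\<forall>\<^sub>F s in rhp. laplace i s = H s / (1 + H s * K2 s) * laplace (\<lambda>t. w t + z' t) s"
    using z z' i unfolding block_iff by auto
  from this nz laplace_diff[OF r si] laplace_add[OF sw sz] laplace_add[OF sw sz']
  have "\<forall>\<^sub>F s in rhp. laplace i s = H s * laplace (\<lambda>t. w t + z t) s"
  proof eventually_elim
    case (elim s)
    have "laplace i s * (1 + H s * K2 s) = H s * (laplace w s + K2 s * laplace r s)"
      using elim(1,3,4,7) by simp
    moreover have z: "laplace z s = K2 s * (laplace r s - laplace i s)" using elim(2,5) by simp
    ultimately show ?case unfolding elim(6) z by (simp add: algebra_simps)
  qed
  then have "block H (\<lambda>t. w t + z t) i"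
    unfolding block_iff using sw sz si by auto
  with w z show ?thesis by blast
qed

lemma inner_loop_transform:
  assumes "block K1 e w" "block K2 (\<lambda>t. r t - i t) z" "block H (\<lambda>t. w t + z t) i" "signal r"
    and "(K2 \<longlongrightarrow> k2) at_infinity" "(H \<longlongrightarrow> 0) at_infinity"
  shows "\<forall>\<^sub>F s in rhp. laplace i s =
    H s * (K1 s * laplace e s + K2 s * laplace r s) / (1 + H s * K2 s)"
proof -
  have "((\<lambda>s. 1 + H s * K2 s) \<longlongrightarrow> 1) at_infinity"
    using tendsto_add[OF tendsto_const[of 1] tendsto_mult[OF assms(6,5)]] by simp
  then have "\<forall>\<^sub>F s in at_infinity. 1 + H s * K2 s \<noteq> 0"
    by (rule tendsto_imp_eventually_ne) simp
  then have nz: "\<forall>\<^sub>F s in rhp. 1 + H s * K2 s \<noteq> 0"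
    by (rule filter_leD[OF rhp_le_at_infinity])
  have sw: "signal w" and sz: "signal z" and si: "signal i"
    using assms unfolding block_iff by auto
  have "\<forall>\<^sub>F s in rhp. laplace w s = K1 s * laplace e s"
    "\<forall>\<^sub>F s in rhp. laplace z s = K2 s * laplace (\<lambda>t. r t - i t) s"
    "\<forall>\<^sub>F s in rhp. laplace i s = H s * laplace (\<lambda>t. w t + z t) s"
    using assms unfolding block_iff by auto
  from this nz laplace_diff[OF assms(4) si] laplace_add[OF sw sz] show ?thesis
  proof eventually_elim
    case (elim s)
    have "laplace i s = H s * (K1 s * laplace e s + K2 s * (laplace r s - laplace i s))"
      using elim by simp
    then have "laplace i s * (1 + H s * K2 s) = H s * (K1 s * laplace e s + K2 s * laplace r s)"
      by (simp add: algebra_simps)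
    with elim(4) show ?case by (simp add: nonzero_eq_divide_eq)
  qed
qed

text \<open>The three channels at once: \<open>a\<close>, \<open>b\<close>, \<open>c\<close> weight \<open>vref\<close>, \<open>iref\<close>, \<open>iload\<close>.\<close>

definition channel :: "real \<Rightarrow> real \<Rightarrow> real \<Rightarrow> behaviour \<Rightarrow> (real \<Rightarrow> real) \<Rightarrow> (real \<Rightarrow> real) \<Rightarrow> bool" where
  "channel a b c B u y \<longleftrightarrow> B (\<lambda>t. a * u t) (\<lambda>t. b * u t) (\<lambda>t. c * u t) y"

lemma from_channel:
  "from_vref = channel 1 0 0" "from_iref = channel 0 1 0" "from_iload = channel 0 0 1"
  by (simp_all add: fun_eq_iff channel_def from_vref_def from_iref_def from_iload_def)

lemma is_transfer_functionD:
  "is_transfer_function R T \<Longrightarrow> signal u \<Longrightarrow> R u y \<Longrightarrow> block T u y"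
  unfolding is_transfer_function_def by blast

text \<open>Changing a transfer function at finitely many points does not affect its limit at
  \<open>0\<close>. Hence each one has the DC gain of \<open>F\<close>, and the quotient of
  polynomials behind \<open>F\<close> provides one.\<close>

lemma steady_state_iff:
  assumes tf: "\<And>a b c T. is_transfer_function (channel a b c B) T \<longleftrightarrow>
      real_rational T \<and> (\<forall>\<^sub>F s in cofinite. T s = F a b c s)"
    and ratf: "\<And>a b c. ratf (F a b c)" and lim: "\<And>a b c. (F a b c \<longlongrightarrow> f a b c) (at 0)"
  shows "steady_state B v r l x \<longleftrightarrow>
    x = f 1 0 0 * of_real v + f 0 1 0 * of_real r + f 0 0 1 * of_real l"
proof -
  have unique: "g = f a b c" if "is_transfer_function (channel a b c B) T" "(T \<longlongrightarrow> g) (at 0)" for a b c T g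
  proof -
    have "\<forall>\<^sub>F s in at 0. T s = F a b c s"
      using that(1) unfolding tf by (intro filter_leD[OF at_le_cofinite]) blast
    with that(2) have "(F a b c \<longlongrightarrow> g) (at 0)" by (rule Lim_transform_eventually)
    then show ?thesis using lim by (rule LIM_unique)
  qed
  have ex: "\<exists>T. is_transfer_function (channel a b c B) T \<and> (T \<longlongrightarrow> f a b c) (at 0)" for a b c
  proof -
    obtain T where T: "real_rational T" and ev: "\<forall>\<^sub>F s in cofinite. F a b c s = T s"
      using ratf[of a b c] unfolding ratf_def by blast
    from ev have "\<forall>\<^sub>F s in cofinite. T s = F a b c s" by eventually_elim simp
    with T have "is_transfer_function (channel a b c B) T" unfolding tf by blast
    moreover have "(T \<longlongrightarrow> f a b c) (at 0)"
      using lim filter_leD[OF at_le_cofinite ev] by (rule Lim_transform_eventually)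
    ultimately show ?thesis by blast
  qed
  show ?thesis
  proof
    assume "steady_state B v r l x"
    then show "x = f 1 0 0 * of_real v + f 0 1 0 * of_real r + f 0 0 1 * of_real l"
      unfolding steady_state_def from_channel using unique by blast
  next
    assume "x = f 1 0 0 * of_real v + f 0 1 0 * of_real r + f 0 0 1 * of_real l"
    then show "steady_state B v r l x"
      unfolding steady_state_def from_channel using ex[of 1 0 0] ex[of 0 1 0] ex[of 0 0 1] by blast
  qed
qed

section \<open>The inner plant at infinity and at DC\<close>

lemma inner_plant_ratf: "ratf (inner_plant \<omega> \<zeta>1 \<zeta>2)"
  unfolding inner_plant_def[abs_def] by (intro ratf_intros)

text \<open>The first-order lag is strictly proper, and the second-order factor tends to
  \<open>1\<close>.\<close>

lemma inner_plant_at_infinity: "(inner_plant \<omega> \<zeta>1 \<zeta>2 \<longlongrightarrow> 0) at_infinity"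
proof -
  define p where "p \<zeta> = [:(complex_of_real omega0)\<^sup>2, 2 * of_real \<zeta> * of_real omega0, 1:]" for \<zeta>
  have "((\<lambda>s. poly [:of_real \<omega>:] s / poly [:of_real \<omega>, 1:] s * (poly (p \<zeta>1) s / poly (p \<zeta>2) s)) \<longlongrightarrow>
      coeff [:complex_of_real \<omega>:] (degree [:complex_of_real \<omega>, 1:]) / lead_coeff [:complex_of_real \<omega>, 1:] *
      (coeff (p \<zeta>1) (degree (p \<zeta>2)) / lead_coeff (p \<zeta>2))) at_infinity"
    by (intro tendsto_mult poly_quotient_tendsto_at_infinity) (auto simp: p_def)
  moreover have "(\<lambda>s. poly [:of_real \<omega>:] s / poly [:of_real \<omega>, 1:] s * (poly (p \<zeta>1) s / poly (p \<zeta>2) s)) =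
      inner_plant \<omega> \<zeta>1 \<zeta>2"
    by (rule ext) (simp add: inner_plant_def p_def algebra_simps power2_eq_square)
  ultimately show ?thesis by simp
qed

lemma omega0_pos: "omega0 > 0"
  by (simp add: omega0_def)

lemma inner_plant_at_0:
  assumes "\<omega> > 0" shows "(inner_plant \<omega> \<zeta>1 \<zeta>2 \<longlongrightarrow> 1) (at 0)"
  unfolding inner_plant_def[abs_def] using assms omega0_pos by (auto intro!: tendsto_eq_intros)

lemma laplace_error_reference:
  assumes "signal iref" "signal e1"
  shows "\<forall>\<^sub>F s in rhp. laplace (\<lambda>t. iref t + \<eta> * e1 t) s = laplace iref s + of_real \<eta> * laplace e1 s"
  using laplace_add[OF assms(1) signal_cmult[OF assms(2)], of \<eta>] by (simp add: laplace_cmult)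

text \<open>The explicit plant is abstracted to what the loops see of it: it is rational, tends to
  \<open>0\<close> at infinity and has unit DC gain. The controllers enter through rationality and
  their two limits.\<close>

locale dc_microgrid =
  fixes m :: nat and C D' \<eta> :: real and Dk :: "nat \<Rightarrow> real" and G Kv Kr :: "complex \<Rightarrow> complex"
    and kv_inf kr_inf kv0 kr0 :: complex
  assumes m: "m \<ge> 1" and C: "C > 0" and D': "0 < D'" "D' < 1" and \<eta>: "\<eta> \<ge> 0"
    and Dk: "\<And>k. k \<in> {1..m} \<Longrightarrow> 0 < Dk k"
    and ratf_G: "ratf G" and ratf_Kv: "ratf Kv" and ratf_Kr: "ratf Kr"
    and G_inf: "(G \<longlongrightarrow> 0) at_infinity" and Kv_inf: "(Kv \<longlongrightarrow> kv_inf) at_infinity"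
    and Kr_inf: "(Kr \<longlongrightarrow> kr_inf) at_infinity"
    and G_0: "(G \<longlongrightarrow> 1) (at 0)" and Kv_0: "(Kv \<longlongrightarrow> kv0) (at 0)" and Kr_0: "(Kr \<longlongrightarrow> kr0) (at 0)"
    and nz1: "1 + of_real D' * kr0 \<noteq> 0" and nz2: "kv0 + of_real \<eta> * kr0 \<noteq> 0"
begin

text \<open>
  For the inputs \<open>(a u, b u, c u)\<close>, \<open>E a b c\<close> is the closed-loop transfer function from \<open>u\<close> to
  \<open>e1\<close> and \<open>I g a b c\<close> the one to the current of a converter with constant multiplier \<open>g\<close>.  The total
  current is \<open>P e1 + Q iref\<close> in either system.
\<close>

definition "H s = of_real D' * G s"
definition "S s = 1 + H s * Kr s"
definition "P s = H s * (Kv s + of_real \<eta> * Kr s) / S s"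
definition "Q s = H s * Kr s / S s"
definition "L s = 1 + dc_link C s * P s"
definition "E a b c s = (of_real a - of_real b * (dc_link C s * Q s) + of_real c * dc_link C s) / L s"
definition "I g a b c s = H s * (Kv s / of_nat m * E a b c s +
    Kr s * (of_real g * (of_real b + of_real \<eta> * E a b c s))) / S s"

section \<open>Closed-loop functions: rationality, limits at infinity and at DC\<close>

lemma ratf_dc_link: "ratf (dc_link C)"
  unfolding dc_link_def[abs_def] by (intro ratf_intros)

lemma ratfs: "ratf H" "ratf S" "ratf P" "ratf Q" "ratf L" "ratf (E a b c)" "ratf (I g a b c)"
proof -
  show H: "ratf H" unfolding H_def[abs_def] by (intro ratf_intros ratf_G)
  show S: "ratf S" unfolding S_def[abs_def] by (intro ratf_intros H ratf_Kr)
  show P: "ratf P" unfolding P_def[abs_def] by (intro ratf_intros H S ratf_Kv ratf_Kr)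
  show Q: "ratf Q" unfolding Q_def[abs_def] by (intro ratf_intros H S ratf_Kr)
  show L: "ratf L" unfolding L_def[abs_def] by (intro ratf_intros P ratf_dc_link)
  show E: "ratf (E a b c)" unfolding E_def[abs_def] by (intro ratf_intros L Q ratf_dc_link)
  show "ratf (I g a b c)" unfolding I_def[abs_def] by (intro ratf_intros E H S ratf_Kv ratf_Kr)
qed

lemma dc_link_inf: "(dc_link C \<longlongrightarrow> 0) at_infinity"
proof -
  have "((\<lambda>s. inverse s * inverse (complex_of_real C)) \<longlongrightarrow> 0 * inverse (of_real C)) at_infinity"
    by (rule tendsto_mult[OF tendsto_inverse_0 tendsto_const])
  then show ?thesis unfolding dc_link_def[abs_def] by (simp add: divide_inverse)
qed

lemma H_inf: "(H \<longlongrightarrow> 0) at_infinity"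
  unfolding H_def[abs_def] using tendsto_mult[OF tendsto_const G_inf] by simp

lemma S_inf: "(S \<longlongrightarrow> 1) at_infinity"
  unfolding S_def[abs_def] using tendsto_add[OF tendsto_const[of 1] tendsto_mult[OF H_inf Kr_inf]] by simp

lemma P_inf: "(P \<longlongrightarrow> 0) at_infinity"
proof -
  have "(P \<longlongrightarrow> 0 * (kv_inf + of_real \<eta> * kr_inf) / 1) at_infinity"
    unfolding P_def[abs_def] by (intro tendsto_intros H_inf S_inf Kv_inf Kr_inf) simp
  then show ?thesis by simp
qed

lemma Q_inf: "(Q \<longlongrightarrow> 0) at_infinity"
proof -
  have "(Q \<longlongrightarrow> 0 * kr_inf / 1) at_infinity"
    unfolding Q_def[abs_def] by (intro tendsto_intros H_inf S_inf Kr_inf) simp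
  then show ?thesis by simp
qed

lemma L_inf: "(L \<longlongrightarrow> 1) at_infinity"
  unfolding L_def[abs_def] using tendsto_add[OF tendsto_const[of 1] tendsto_mult[OF dc_link_inf P_inf]] by simp

lemma E_inf: "(E a b c \<longlongrightarrow> of_real a) at_infinity"
proof -
  have "(E a b c \<longlongrightarrow> (of_real a - of_real b * (0 * 0) + of_real c * 0) / 1) at_infinity"
    unfolding E_def[abs_def] by (intro tendsto_intros dc_link_inf L_inf Q_inf) simp
  then show ?thesis by simp
qed

lemma L_nz: "\<forall>\<^sub>F s in rhp. L s \<noteq> 0"
  by (rule filter_leD[OF rhp_le_at_infinity tendsto_imp_eventually_ne[OF L_inf]]) simp

lemma H_0: "(H \<longlongrightarrow> of_real D') (at 0)"
  unfolding H_def[abs_def] using tendsto_mult[OF tendsto_const G_0] by simp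

lemma S_0: "(S \<longlongrightarrow> 1 + of_real D' * kr0) (at 0)"
  unfolding S_def[abs_def] by (intro tendsto_intros H_0 Kr_0)

lemma P_0: "(P \<longlongrightarrow> of_real D' * (kv0 + of_real \<eta> * kr0) / (1 + of_real D' * kr0)) (at 0)"
  unfolding P_def[abs_def] by (intro tendsto_intros H_0 S_0 Kv_0 Kr_0 nz1)

lemma Q_0: "(Q \<longlongrightarrow> of_real D' * kr0 / (1 + of_real D' * kr0)) (at 0)"
  unfolding Q_def[abs_def] by (intro tendsto_intros H_0 S_0 Kr_0 nz1)

text \<open>The weight \<open>a\<close> of \<open>vref\<close> is absent since the integrator makes
  the loop track constant references. What remains is \<open>(c - b Q) / P\<close> at
  \<open>0\<close>, with the common denominator \<open>1 + D' kr0\<close> cleared.\<close>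

definition "E0 b c = (- of_real b * (of_real D' * kr0) + of_real c * (1 + of_real D' * kr0)) /
    (of_real D' * (kv0 + of_real \<eta> * kr0))"

text \<open>The integrator has no DC gain; multiplying numerator and denominator by \<open>s C\<close> removes it.\<close>

lemma E_0: "(E a b c \<longlongrightarrow> E0 b c) (at 0)"
proof -
  define X where "X = kv0 + of_real \<eta> * kr0"
  define Y where "Y = 1 + of_real D' * kr0"
  have nz: "X \<noteq> 0" "Y \<noteq> 0" "of_real D' \<noteq> (0::complex)" using nz1 nz2 D' by (auto simp: X_def Y_def)
  have "((\<lambda>s. (of_real a * (s * of_real C) - of_real b * Q s + of_real c) / (s * of_real C + P s)) \<longlongrightarrow>
      (of_real a * (0 * of_real C) - of_real b * (of_real D' * kr0 / Y) + of_real c) /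
      (0 * of_real C + of_real D' * X / Y)) (at 0)"
    unfolding X_def Y_def by (intro tendsto_intros Q_0 P_0) (use nz in \<open>simp add: X_def Y_def\<close>)
  also have "(of_real a * (0 * of_real C) - of_real b * (of_real D' * kr0 / Y) + of_real c) /
      (0 * of_real C + of_real D' * X / Y) = E0 b c"
    unfolding E0_def X_def[symmetric] Y_def[symmetric] using nz by (simp add: field_simps)
  finally have lim: "((\<lambda>s. (of_real a * (s * of_real C) - of_real b * Q s + of_real c) /
      (s * of_real C + P s)) \<longlongrightarrow> E0 b c) (at 0)" .
  have "(of_real a * (s * of_real C) - of_real b * Q s + of_real c) / (s * of_real C + P s) = E a b c s"
    if "s \<noteq> 0" for s
  proof -
    define d where "d = s * of_real C"
    have d: "d \<noteq> 0" using that C by (simp add: d_def)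
    have "E a b c s = (d * (of_real a - of_real b * (1 / d * Q s) + of_real c * (1 / d))) /
        (d * (1 + 1 / d * P s))"
      using d by (simp add: E_def L_def dc_link_def d_def)
    also have "\<dots> = (of_real a * d - of_real b * Q s + of_real c) / (d + P s)"
      using d by (simp add: algebra_simps)
    finally show ?thesis by (simp add: d_def)
  qed
  then have "\<forall>\<^sub>F s in at 0. (of_real a * (s * of_real C) - of_real b * Q s + of_real c) /
      (s * of_real C + P s) = E a b c s"
    unfolding eventually_at_topological by blast
  with lim show ?thesis by (rule Lim_transform_eventually)
qed

lemma I_0: "(I g a b c \<longlongrightarrow> of_real D' * (kv0 / of_nat m * E0 b c +
    kr0 * (of_real g * (of_real b + of_real \<eta> * E0 b c))) / (1 + of_real D' * kr0)) (at 0)"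
  unfolding I_def[abs_def] by (intro tendsto_intros E_0 H_0 S_0 Kv_0 Kr_0 nz1) (use m in simp)

section \<open>The voltage loop, common to both systems\<close>

lemma error_exists:
  assumes "signal vref" "signal iref" "signal iload"
  shows "\<exists>e1. signal e1 \<and> (\<forall>\<^sub>F s in rhp. laplace e1 s =
    (laplace vref s - dc_link C s * Q s * laplace iref s + dc_link C s * laplace iload s) / L s)"
proof -
  \<comment> \<open>By linearity the error is the sum of the responses of the three channels, each
    of which is realizable by \<open>E_inf\<close>.\<close>
  obtain x y z where xyz: "block (E 1 0 0) vref x" "block (E 0 1 0) iref y" "block (E 0 0 1) iload z"
    using ratf_realizable[OF ratfs(6) E_inf] assms by metis
  then have sg: "signal x" "signal y" "signal z" unfolding block_iff by auto
  have "\<forall>\<^sub>F s in rhp. laplace x s = E 1 0 0 s * laplace vref s"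
    "\<forall>\<^sub>F s in rhp. laplace y s = E 0 1 0 s * laplace iref s"
    "\<forall>\<^sub>F s in rhp. laplace z s = E 0 0 1 s * laplace iload s"
    using xyz unfolding block_iff by auto
  from this laplace_add[OF sg(1,2)] laplace_add[OF signal_add[OF sg(1,2)] sg(3)]
  have "\<forall>\<^sub>F s in rhp. laplace (\<lambda>t. x t + y t + z t) s =
    (laplace vref s - dc_link C s * Q s * laplace iref s + dc_link C s * laplace iload s) / L s"
    by eventually_elim (simp add: E_def add_divide_distrib diff_divide_distrib)
  with sg show ?thesis by (intro exI[of _ "\<lambda>t. x t + y t + z t"]) auto
qed

text \<open>The error is chosen before any converter is looked at. Whatever current has the
  transform \<open>P e1 + Q iref\<close> then closes the voltage loop with
  \<open>V = vref - e1\<close>, be it the current of one converter or a sum.\<close>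

lemma outer_loop_exists:
  assumes v: "signal vref" and r: "signal iref" and l: "signal iload"
  shows "\<exists>e1. signal e1 \<and> (\<forall>i. signal i \<and>
    (\<forall>\<^sub>F s in rhp. laplace i s = P s * laplace e1 s + Q s * laplace iref s) \<longrightarrow>
    block (dc_link C) (\<lambda>t. - iload t + i t) (\<lambda>t. vref t - e1 t))"
proof -
  obtain e1 where e1: "signal e1" and eq: "\<forall>\<^sub>F s in rhp. laplace e1 s =
    (laplace vref s - dc_link C s * Q s * laplace iref s + dc_link C s * laplace iload s) / L s"
    using error_exists[OF assms] by blast
  have "block (dc_link C) (\<lambda>t. - iload t + i t) (\<lambda>t. vref t - e1 t)"
    if i: "signal i" "\<forall>\<^sub>F s in rhp. laplace i s = P s * laplace e1 s + Q s * laplace iref s" for i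
  proof -
    from eq i(2) L_nz laplace_add[OF signal_minus[OF l] i(1), unfolded laplace_minus] laplace_diff[OF v e1]
    have "\<forall>\<^sub>F s in rhp. laplace (\<lambda>t. vref t - e1 t) s = dc_link C s * laplace (\<lambda>t. - iload t + i t) s"
    proof eventually_elim
      case (elim s)
      have "laplace e1 s * L s =
        laplace vref s - dc_link C s * Q s * laplace iref s + dc_link C s * laplace iload s"
        using elim by simp
      then show ?case unfolding elim(4,5) elim(2) by (simp add: L_def algebra_simps)
    qed
    with v l e1 i show ?thesis unfolding block_iff by auto
  qed
  with e1 show ?thesis by blast
qed

text \<open>Conversely, in every solution with such a total current the transform of
  \<open>e1\<close> satisfies a linear equation with coefficient \<open>L\<close>, which is nonzero
  far to the right.\<close>

lemma outer_loop_transform: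
  assumes v: "signal vref" and l: "signal iload" and V: "signal V" and i: "signal i"
    and e1: "\<forall>t\<ge>0. e1 t = vref t - V t"
    and eq: "\<forall>\<^sub>F s in rhp. laplace i s = P s * laplace e1 s + Q s * laplace iref s"
    and b: "block (dc_link C) (\<lambda>t. - iload t + i t) V"
  shows "\<forall>\<^sub>F s in rhp. laplace e1 s =
    (laplace vref s - dc_link C s * Q s * laplace iref s + dc_link C s * laplace iload s) / L s"
proof -
  have "laplace e1 = laplace (\<lambda>t. vref t - V t)" by (rule laplace_cong) (use e1 in simp)
  with laplace_diff[OF v V] have e: "\<forall>\<^sub>F s in rhp. laplace e1 s = laplace vref s - laplace V s" by simp
  have "\<forall>\<^sub>F s in rhp. laplace V s = dc_link C s * laplace (\<lambda>t. - iload t + i t) s"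
    using b unfolding block_iff by blast
  from this e eq L_nz laplace_add[OF signal_minus[OF l] i, unfolded laplace_minus] show ?thesis
  proof eventually_elim
    case (elim s)
    have "laplace e1 s = laplace vref s -
        dc_link C s * (- laplace iload s + (P s * laplace e1 s + Q s * laplace iref s))"
      using elim(1,2,3) unfolding elim(5) by simp
    then have "laplace e1 s * L s =
        laplace vref s - dc_link C s * Q s * laplace iref s + dc_link C s * laplace iload s"
      by (simp add: L_def algebra_simps)
    with elim(4) show ?case by (simp add: nonzero_eq_divide_eq)
  qed
qed

lemma error_channel:
  assumes "\<forall>\<^sub>F s in rhp. laplace e1 s =
    (laplace (\<lambda>t. a * u t) s - dc_link C s * Q s * laplace (\<lambda>t. b * u t) s
      + dc_link C s * laplace (\<lambda>t. c * u t) s) / L s"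
  shows "\<forall>\<^sub>F s in rhp. laplace e1 s = E a b c s * laplace u s"
  using assms by eventually_elim (simp add: laplace_cmult E_def algebra_simps)

lemma P_Q_eq: "P s * e + Q s * r = H s * (Kv s * e + Kr s * (r + of_real \<eta> * e)) / S s"
  by (simp add: P_def Q_def add_divide_distrib[symmetric] algebra_simps)

subsection \<open>The single converter\<close>

lemma single_exists:
  assumes v: "signal vref" and r: "signal iref" and l: "signal iload"
  shows "\<exists>V. single_V C D' \<eta> G Kv Kr vref iref iload V"
proof -
  obtain e1 where e1: "signal e1" and *: "\<And>i. signal i \<Longrightarrow>
    (\<forall>\<^sub>F s in rhp. laplace i s = P s * laplace e1 s + Q s * laplace iref s) \<Longrightarrow>
    block (dc_link C) (\<lambda>t. - iload t + i t) (\<lambda>t. vref t - e1 t)"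
    using outer_loop_exists[OF assms] by blast
  define rr where "rr = (\<lambda>t. iref t + \<eta> * e1 t)"
  have rr: "signal rr" unfolding rr_def by (intro signal_add signal_cmult r e1)
  obtain w z i where wzi: "block Kv e1 w" "block Kr (\<lambda>t. rr t - i t) z" "block H (\<lambda>t. w t + z t) i"
    using inner_loop_exists[OF ratf_Kv Kv_inf ratf_Kr Kr_inf ratfs(1) H_inf e1 rr] by blast
  then have si: "signal i" unfolding block_iff by blast
  have "\<forall>\<^sub>F s in rhp. laplace i s = P s * laplace e1 s + Q s * laplace iref s"
    using inner_loop_transform[OF wzi rr Kr_inf H_inf] laplace_error_reference[OF r e1, of \<eta>]
    by eventually_elim (simp add: P_Q_eq S_def rr_def)
  from *[OF si this] have V: "block (dc_link C) (\<lambda>t. - iload t + i t) (\<lambda>t. vref t - e1 t)" .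
  \<comment> \<open>The inner loop around \<open>H = D' G\<close> delivers the output current;
    dividing it by \<open>D'\<close> gives the inductor current.\<close>
  have "block G (\<lambda>t. w t + z t) (\<lambda>t. 1 / D' * i t)"
    unfolding block_iff
  proof (intro conjI signal_cmult si)
    show "\<forall>\<^sub>F s in rhp. laplace (\<lambda>t. 1 / D' * i t) s = G s * laplace (\<lambda>t. w t + z t) s"
      using wzi(3)[unfolded block_iff, THEN conjunct2, THEN conjunct2]
      by eventually_elim (use D' in \<open>simp only: laplace_cmult, simp add: H_def\<close>)
  qed (use wzi(3) in \<open>simp add: block_iff\<close>)
  then have "single_system C D' \<eta> G Kv Kr vref iref iload e1 (\<lambda>t. rr t - i t) (\<lambda>t. w t + z t)
      (\<lambda>t. 1 / D' * i t) (\<lambda>t. vref t - e1 t)"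
    unfolding single_system_def using wzi V D' by (auto simp: rr_def)
  then show ?thesis unfolding single_V_def by blast
qed

text \<open>By \<open>V = a u - e1\<close> the gain of the voltage is \<open>a\<close> minus that of
  the error. \<open>multi_error\<close> arrives at the same function, which is the system
  equivalence.\<close>

lemma single_block:
  assumes u: "signal u" and V: "channel a b c (single_V C D' \<eta> G Kv Kr) u V"
  shows "block (\<lambda>s. of_real a - E a b c s) u V"
proof -
  let ?v = "\<lambda>t. a * u t" and ?r = "\<lambda>t. b * u t" and ?l = "\<lambda>t. c * u t"
  have sg: "signal ?v" "signal ?r" "signal ?l" by (intro signal_cmult u)+
  obtain e1 e2 uu iL where "single_system C D' \<eta> G Kv Kr ?v ?r ?l e1 e2 uu iL V"
    using V unfolding channel_def single_V_def by blast
  then obtain w z where e1: "\<forall>t\<ge>0. e1 t = ?v t - V t"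
    and e2: "\<forall>t\<ge>0. e2 t = ?r t + \<eta> * e1 t - D' * iL t"
    and w: "block Kv e1 w" and z: "block Kr e2 z" and uu: "\<forall>t\<ge>0. uu t = w t + z t"
    and iL: "block G uu iL" and V: "block (dc_link C) (\<lambda>t. - ?l t + D' * iL t) V"
    unfolding single_system_def by blast
  define i where "i = (\<lambda>t. D' * iL t)"
  define rr where "rr = (\<lambda>t. ?r t + \<eta> * e1 t)"
  have V': "block (dc_link C) (\<lambda>t. - ?l t + i t) V" using V by (simp add: i_def)
  have se1: "signal e1" and sV: "signal V" and si: "signal i"
    using w V iL unfolding block_iff i_def by auto
  have rr: "signal rr" unfolding rr_def by (intro signal_add signal_cmult sg se1 u)
  have z': "block Kr (\<lambda>t. rr t - i t) z"
    by (rule block_cong_signals[OF z]) (simp_all add: e2 rr_def i_def)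
  have "block G (\<lambda>t. w t + z t) iL"
    by (rule block_cong_signals[OF iL]) (simp_all add: uu)
  then have i: "block H (\<lambda>t. w t + z t) i"
    using si unfolding block_iff by (auto simp: i_def laplace_cmult H_def elim!: eventually_mono)
  have "\<forall>\<^sub>F s in rhp. laplace i s = P s * laplace e1 s + Q s * laplace ?r s"
    using inner_loop_transform[OF w z' i rr Kr_inf H_inf] laplace_error_reference[OF sg(2) se1, of \<eta>]
    by eventually_elim (simp add: P_Q_eq S_def rr_def)
  from error_channel[OF outer_loop_transform[OF sg(1,3) sV si e1 this V']]
  have e: "\<forall>\<^sub>F s in rhp. laplace e1 s = E a b c s * laplace u s" .
  have "laplace e1 = laplace (\<lambda>t. ?v t - V t)" by (rule laplace_cong) (use e1 in simp)
  with laplace_diff[OF sg(1) sV] have "\<forall>\<^sub>F s in rhp. laplace e1 s = laplace ?v s - laplace V s" by simp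
  with e have "\<forall>\<^sub>F s in rhp. laplace V s = (of_real a - E a b c s) * laplace u s"
    by eventually_elim (simp add: laplace_cmult algebra_simps)
  with u sV show ?thesis unfolding block_iff by blast
qed

subsection \<open>Parallel converters\<close>

text \<open>The share of one converter enters only as the transform of a product of signals, which
  does not factor. In the time domain these products add up to \<open>iref + \<eta> e1\<close>, and
  the \<open>m\<close> copies of \<open>Kv / m\<close> add up to \<open>Kv\<close>.\<close>

lemma sum_currents_transform:
  assumes e1: "signal e1" and r: "signal iref"
    and \<gamma>: "\<And>k. k \<in> {1..m} \<Longrightarrow> signal (\<gamma> k)" "\<forall>t\<ge>0. (\<Sum>k=1..m. \<gamma> k t) = 1"
    and i: "\<And>k. k \<in> {1..m} \<Longrightarrow> signal (i k)"
    and eq: "\<And>k. k \<in> {1..m} \<Longrightarrow> \<forall>\<^sub>F s in rhp. laplace (i k) s =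
      H s * (Kv s / of_nat m * laplace e1 s + Kr s * laplace (\<lambda>t. \<gamma> k t * (iref t + \<eta> * e1 t)) s) / S s"
  shows "\<forall>\<^sub>F s in rhp. laplace (\<lambda>t. \<Sum>k=1..m. i k t) s = P s * laplace e1 s + Q s * laplace iref s"
proof -
  define rr where "rr = (\<lambda>t. iref t + \<eta> * e1 t)"
  have rr: "signal rr" unfolding rr_def by (intro signal_add signal_cmult r e1)
  have sg: "signal (\<lambda>t. \<gamma> k t * rr t)" if "k \<in> {1..m}" for k
    using \<gamma>(1)[OF that] rr by (rule signal_mult)
  have "laplace (\<lambda>t. \<Sum>k=1..m. \<gamma> k t * rr t) = laplace rr"
  proof (rule laplace_cong)
    fix t :: real assume "t \<ge> 0"
    with \<gamma>(2) show "(\<Sum>k=1..m. \<gamma> k t * rr t) = rr t"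
      unfolding sum_distrib_right[symmetric] by simp
  qed
  with laplace_sum[of "{1..m}" "\<lambda>k t. \<gamma> k t * rr t", OF _ sg]
  have 1: "\<forall>\<^sub>F s in rhp. laplace rr s = (\<Sum>k=1..m. laplace (\<lambda>t. \<gamma> k t * rr t) s)" by simp
  have 2: "\<forall>\<^sub>F s in rhp. \<forall>k\<in>{1..m}. laplace (i k) s =
      H s * (Kv s / of_nat m * laplace e1 s + Kr s * laplace (\<lambda>t. \<gamma> k t * rr t) s) / S s"
    using eq unfolding rr_def by (intro eventually_ball_finite) auto
  have 3: "\<forall>\<^sub>F s in rhp. laplace (\<lambda>t. \<Sum>k=1..m. i k t) s = (\<Sum>k=1..m. laplace (i k) s)"
    by (rule laplace_sum) (use i in auto)
  from 1 2 3 laplace_error_reference[OF r e1, of \<eta>] show ?thesis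
  proof eventually_elim
    case (elim s)
    have "laplace (\<lambda>t. \<Sum>k=1..m. i k t) s =
      (\<Sum>k=1..m. H s * (Kv s / of_nat m * laplace e1 s + Kr s * laplace (\<lambda>t. \<gamma> k t * rr t) s) / S s)"
      unfolding elim(3) by (rule sum.cong[OF refl]) (use elim(2) in blast)
    also have "\<dots> = H s * (\<Sum>k=1..m. Kv s / of_nat m * laplace e1 s + Kr s * laplace (\<lambda>t. \<gamma> k t * rr t) s) / S s"
      by (simp only: sum_distrib_left sum_divide_distrib)
    also have "(\<Sum>k=1..m. Kv s / of_nat m * laplace e1 s + Kr s * laplace (\<lambda>t. \<gamma> k t * rr t) s) =
        Kv s * laplace e1 s + Kr s * laplace rr s"
      using m by (simp add: sum.distrib sum_distrib_left elim(1))
    finally show ?case using elim(4) by (simp add: P_Q_eq rr_def)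
  qed
qed

lemma multi_currents:
  assumes M: "multi_system m C D' Dk \<eta> \<gamma> G Kv Kr vref iref iload e1 e2 i iL V"
    and r: "signal iref" and \<gamma>: "\<And>k. k \<in> {1..m} \<Longrightarrow> signal (\<gamma> k)"
  shows "signal e1" and "k \<in> {1..m} \<Longrightarrow> signal (i k)"
    and "k \<in> {1..m} \<Longrightarrow> \<forall>\<^sub>F s in rhp. laplace (i k) s =
      H s * (Kv s / of_nat m * laplace e1 s + Kr s * laplace (\<lambda>t. \<gamma> k t * (iref t + \<eta> * e1 t)) s) / S s"
proof -
  have M': "(\<forall>t\<ge>0. e2 k t = \<gamma> k t * (iref t + \<eta> * e1 t) - i k t) \<and>
      (\<exists>w z. block (\<lambda>s. Kv s / of_nat m) e1 w \<and> block Kr (e2 k) z \<and> block H (\<lambda>t. w t + z t) (i k))"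
    if "k \<in> {1..m}" for k
    using M that unfolding multi_system_def H_def[abs_def] by blast
  \<comment> \<open>That \<open>e1\<close> is a signal is known only through a block that it feeds;
    converter \<open>1\<close> supplies one.\<close>
  have "1 \<in> {1..m}" using m by simp
  from M'[OF this] show e1: "signal e1" unfolding block_iff by blast
  assume k: "k \<in> {1..m}"
  from M'[OF k] obtain w z where w: "block (\<lambda>s. Kv s / of_nat m) e1 w"
    and e2: "\<forall>t\<ge>0. e2 k t = \<gamma> k t * (iref t + \<eta> * e1 t) - i k t"
    and z: "block Kr (e2 k) z" and ik: "block H (\<lambda>t. w t + z t) (i k)" by blast
  show "signal (i k)" using ik unfolding block_iff by blast
  have z': "block Kr (\<lambda>t. \<gamma> k t * (iref t + \<eta> * e1 t) - i k t) z"
    by (rule block_cong_signals[OF z]) (simp_all add: e2)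
  have "signal (\<lambda>t. \<gamma> k t * (iref t + \<eta> * e1 t))"
    by (intro signal_mult[OF \<gamma>[OF k]] signal_add signal_cmult r e1)
  from inner_loop_transform[OF w z' ik this Kr_inf H_inf]
  show "\<forall>\<^sub>F s in rhp. laplace (i k) s =
      H s * (Kv s / of_nat m * laplace e1 s + Kr s * laplace (\<lambda>t. \<gamma> k t * (iref t + \<eta> * e1 t)) s) / S s"
    by (simp add: S_def)
qed

text \<open>With \<open>e1\<close> fixed in advance the converters decouple, and each inner loop is
  solved on its own. The sum of the currents has the transform that closes the voltage loop, and
  division by \<open>Dk k > 0\<close> gives the inductor currents.\<close>

lemma multi_exists:
  assumes v: "signal vref" and r: "signal iref" and l: "signal iload"
    and \<gamma>: "\<And>k. k \<in> {1..m} \<Longrightarrow> signal (\<gamma> k)" "\<forall>t\<ge>0. (\<Sum>k=1..m. \<gamma> k t) = 1"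
  shows "\<exists>e1 e2 i iL V. multi_system m C D' Dk \<eta> \<gamma> G Kv Kr vref iref iload e1 e2 i iL V"
proof -
  obtain e1 where e1: "signal e1" and *: "\<And>i. signal i \<Longrightarrow>
    (\<forall>\<^sub>F s in rhp. laplace i s = P s * laplace e1 s + Q s * laplace iref s) \<Longrightarrow>
    block (dc_link C) (\<lambda>t. - iload t + i t) (\<lambda>t. vref t - e1 t)"
    using outer_loop_exists[OF assms(1-3)] by blast
  have Kv_m: "ratf (\<lambda>s. Kv s / of_nat m)" by (intro ratf_intros ratf_Kv)
  have Kv_m_inf: "((\<lambda>s. Kv s / of_nat m) \<longlongrightarrow> kv_inf / of_nat m) at_infinity"
    by (intro tendsto_intros Kv_inf) (use m in simp)
  define rr where "rr k t = \<gamma> k t * (iref t + \<eta> * e1 t)" for k t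
  have rr: "signal (rr k)" if "k \<in> {1..m}" for k
    unfolding rr_def[abs_def] by (intro signal_mult[OF \<gamma>(1)[OF that]] signal_add signal_cmult r e1)
  have "\<forall>k\<in>{1..m}. \<exists>i w z. block (\<lambda>s. Kv s / of_nat m) e1 w \<and>
      block Kr (\<lambda>t. rr k t - i t) z \<and> block H (\<lambda>t. w t + z t) i"
    using inner_loop_exists[OF Kv_m Kv_m_inf ratf_Kr Kr_inf ratfs(1) H_inf e1 rr] by blast
  then obtain i where i: "\<forall>k\<in>{1..m}. \<exists>w z. block (\<lambda>s. Kv s / of_nat m) e1 w \<and>
      block Kr (\<lambda>t. rr k t - i k t) z \<and> block H (\<lambda>t. w t + z t) (i k)"
    by (rule bchoice[THEN exE])
  have si: "signal (i k)" if "k \<in> {1..m}" for k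
    using i that unfolding block_iff by blast
  have eq: "\<forall>\<^sub>F s in rhp. laplace (i k) s =
      H s * (Kv s / of_nat m * laplace e1 s + Kr s * laplace (\<lambda>t. \<gamma> k t * (iref t + \<eta> * e1 t)) s) / S s"
    if k: "k \<in> {1..m}" for k
  proof -
    obtain w z where wz: "block (\<lambda>s. Kv s / of_nat m) e1 w"
      "block Kr (\<lambda>t. rr k t - i k t) z" "block H (\<lambda>t. w t + z t) (i k)"
      using i k by blast
    from inner_loop_transform[OF wz rr[OF k] Kr_inf H_inf] show ?thesis
      by (simp add: S_def rr_def[abs_def])
  qed
  have "block (dc_link C) (\<lambda>t. - iload t + (\<Sum>k=1..m. i k t)) (\<lambda>t. vref t - e1 t)"
    by (rule *[OF signal_sum[OF si] sum_currents_transform[OF e1 r \<gamma> si eq]])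
  moreover have Dk_nz: "\<forall>k\<in>{1..m}. Dk k \<noteq> 0" using Dk by force
  ultimately have "multi_system m C D' Dk \<eta> \<gamma> G Kv Kr vref iref iload e1 (\<lambda>k t. rr k t - i k t) i
      (\<lambda>k t. i k t / Dk k) (\<lambda>t. vref t - e1 t)"
    unfolding multi_system_def H_def[symmetric] rr_def[abs_def, symmetric]
    using i Dk_nz by (auto simp: rr_def)
  then show ?thesis by blast
qed

text \<open>Error and voltage see the converters only through the total current, so the multipliers
  may vary in time here.\<close>

lemma multi_error:
  assumes M: "multi_system m C D' Dk \<eta> \<gamma> G Kv Kr (\<lambda>t. a * u t) (\<lambda>t. b * u t) (\<lambda>t. c * u t) e1 e2 i iL V"
    and u: "signal u"
    and \<gamma>: "\<And>k. k \<in> {1..m} \<Longrightarrow> signal (\<gamma> k)" "\<forall>t\<ge>0. (\<Sum>k=1..m. \<gamma> k t) = 1"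
  shows "block (E a b c) u e1" and "block (\<lambda>s. of_real a - E a b c s) u V"
proof -
  have sg: "signal (\<lambda>t. x * u t)" for x by (intro signal_cmult u)
  note cur = multi_currents[OF M sg \<gamma>(1)]
  have e1: "\<forall>t\<ge>0. e1 t = a * u t - V t" and V: "block (dc_link C) (\<lambda>t. - (c * u t) + (\<Sum>k=1..m. i k t)) V"
    using M unfolding multi_system_def by auto
  then have sV: "signal V" unfolding block_iff by blast
  have "signal (\<lambda>t. \<Sum>k=1..m. i k t)" by (rule signal_sum) (rule cur(2))
  from error_channel[OF outer_loop_transform[OF sg sg sV this e1
        sum_currents_transform[OF cur(1) sg \<gamma> cur(2,3)] V]]
  have e: "\<forall>\<^sub>F s in rhp. laplace e1 s = E a b c s * laplace u s" by simp
  with cur(1) u show "block (E a b c) u e1" unfolding block_iff by blast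
  have "laplace e1 = laplace (\<lambda>t. a * u t - V t)" by (rule laplace_cong) (use e1 in simp)
  with laplace_diff[OF sg sV, of a] have "\<forall>\<^sub>F s in rhp. laplace e1 s = laplace (\<lambda>t. a * u t) s - laplace V s" by simp
  with e have "\<forall>\<^sub>F s in rhp. laplace V s = (of_real a - E a b c s) * laplace u s"
    by eventually_elim (simp add: laplace_cmult algebra_simps)
  with u sV show "block (\<lambda>s. of_real a - E a b c s) u V" unfolding block_iff by blast
qed

lemma laplace_constant_share:
  assumes "signal iref" "signal e1"
  shows "\<forall>\<^sub>F s in rhp. laplace (\<lambda>t. g * (iref t + \<eta> * e1 t)) s =
    of_real g * (laplace iref s + of_real \<eta> * laplace e1 s)"
  using laplace_error_reference[OF assms, of \<eta>] by (simp add: laplace_cmult)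

text \<open>A constant multiplier commutes with the Laplace transform, so now each single current
  has a transfer function.\<close>

lemma multi_current_block:
  assumes M: "multi_system m C D' Dk \<eta> (\<lambda>k t. \<gamma> k) G Kv Kr (\<lambda>t. a * u t) (\<lambda>t. b * u t) (\<lambda>t. c * u t) e1 e2 i iL V"
    and u: "signal u" and \<gamma>: "(\<Sum>k=1..m. \<gamma> k) = 1" and k: "k \<in> {1..m}"
  shows "block (I (\<gamma> k) a b c) u (\<lambda>t. Dk k * iL k t)"
proof -
  have sg: "signal (\<lambda>t. x * u t)" for x by (intro signal_cmult u)
  note cur = multi_currents[OF M sg signal_const]
  have "block (E a b c) u e1" by (rule multi_error[OF M u signal_const]) (use \<gamma> in simp)
  then have "\<forall>\<^sub>F s in rhp. laplace e1 s = E a b c s * laplace u s" unfolding block_iff by blast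
  from this cur(3)[OF k] laplace_constant_share[OF sg cur(1), of "\<gamma> k" b]
  have "\<forall>\<^sub>F s in rhp. laplace (i k) s = I (\<gamma> k) a b c s * laplace u s"
    by eventually_elim (simp add: I_def laplace_cmult algebra_simps)
  then have b: "block (I (\<gamma> k) a b c) u (i k)" using u cur(2)[OF k] unfolding block_iff by blast
  have "\<forall>t\<ge>0. i k t = Dk k * iL k t" using M k unfolding multi_system_def by blast
  with b show ?thesis by (intro block_cong_signals[OF b]) simp_all
qed

text \<open>Only the converter equations enter, and the transform of \<open>e1\<close> is left
  unsolved: the multipliers may have any sum, and \<open>E\<close> describes the error only when
  that sum is \<open>1\<close>.\<close>

lemma current_difference:
  assumes M: "multi_system m C D' Dk \<eta> (\<lambda>k t. \<gamma> k) G Kv Kr vref iref iload e1 e2 i iL V"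
    and r: "signal iref" and \<gamma>: "\<gamma> k > 0" "\<gamma> l > 0" and k: "k \<in> {1..m}" and l: "l \<in> {1..m}"
  shows "\<forall>\<^sub>F s in rhp. laplace (\<lambda>t. Dk k * iL k t) s / of_real (\<gamma> k) - laplace (\<lambda>t. Dk l * iL l t) s / of_real (\<gamma> l) =
    T2_tilde m D' G Kv Kr s * (1 / of_real (\<gamma> k) - 1 / of_real (\<gamma> l)) * laplace e1 s"
proof -
  note cur = multi_currents[OF M r signal_const]
  have i: "laplace (\<lambda>t. Dk k * iL k t) = laplace (i k)" if "k \<in> {1..m}" for k
    by (rule laplace_cong) (use M that in \<open>auto simp: multi_system_def\<close>)
  from cur(3)[OF k] cur(3)[OF l] laplace_constant_share[OF r cur(1), of "\<gamma> k"]
    laplace_constant_share[OF r cur(1), of "\<gamma> l"] show ?thesis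
  proof eventually_elim
    case (elim s)
    define h where "h = H s / S s"
    have h: "H s * x / S s = h * x" for x by (simp add: h_def)
    \<comment> \<open>\<open>A\<close> is the voltage correction, equal for all converters, and
      \<open>B\<close> the current per unit of share. Converter \<open>k\<close> carries
      \<open>A + \<gamma> k B\<close>, so \<open>B\<close> cancels in the difference of the scaled
      currents.\<close>
    define A where "A = h * (Kv s / of_nat m * laplace e1 s)"
    define B where "B = h * (Kr s * (laplace iref s + of_real \<eta> * laplace e1 s))"
    have "laplace (i k) s = A + of_real (\<gamma> k) * B" "laplace (i l) s = A + of_real (\<gamma> l) * B"
      unfolding elim(1,2) unfolding elim(3,4) h by (simp_all add: A_def B_def algebra_simps)
    moreover have "A = T2_tilde m D' G Kv Kr s * laplace e1 s"
      by (simp add: A_def h_def T2_tilde_def H_def S_def mult_ac)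
    ultimately show ?case using \<gamma> k l
      by (simp add: i add_divide_distrib) (simp add: algebra_simps)
  qed
qed

subsection \<open>Transfer functions and steady states\<close>

lemma single_transfer_function:
  "is_transfer_function (channel a b c (single_V C D' \<eta> G Kv Kr)) T \<longleftrightarrow>
    real_rational T \<and> (\<forall>\<^sub>F s in cofinite. T s = of_real a - E a b c s)"
proof (rule is_transfer_function_iff)
  show "ratf (\<lambda>s. of_real a - E a b c s)" by (intro ratf_intros ratfs)
  show "\<exists>V. channel a b c (single_V C D' \<eta> G Kv Kr) u V" if "signal u" for u
    unfolding channel_def by (intro single_exists signal_cmult that)
qed (rule single_block)

lemma multi_V_transfer_function:
  assumes \<gamma>: "\<And>k. k \<in> {1..m} \<Longrightarrow> signal (\<gamma> k)" "\<forall>t\<ge>0. (\<Sum>k=1..m. \<gamma> k t) = 1"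
  shows "is_transfer_function (channel a b c (multi_V m C D' Dk \<eta> \<gamma> G Kv Kr)) T \<longleftrightarrow>
    real_rational T \<and> (\<forall>\<^sub>F s in cofinite. T s = of_real a - E a b c s)"
proof (rule is_transfer_function_iff)
  show "ratf (\<lambda>s. of_real a - E a b c s)" by (intro ratf_intros ratfs)
  show "\<exists>V. channel a b c (multi_V m C D' Dk \<eta> \<gamma> G Kv Kr) u V" if "signal u" for u
    unfolding channel_def multi_V_def
    using multi_exists[OF signal_cmult[OF that] signal_cmult[OF that] signal_cmult[OF that] \<gamma>] by blast
  show "block (\<lambda>s. of_real a - E a b c s) u V"
    if "signal u" "channel a b c (multi_V m C D' Dk \<eta> \<gamma> G Kv Kr) u V" for u V
    using that multi_error(2)[OF _ that(1) \<gamma>] unfolding channel_def multi_V_def by blast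
qed

context
  fixes \<gamma> :: "nat \<Rightarrow> real"
  assumes \<gamma>: "(\<Sum>k=1..m. \<gamma> k) = 1"
begin

lemma multi_e1_transfer_function:
  "is_transfer_function (channel a b c (multi_e1 m C D' Dk \<eta> (\<lambda>k t. \<gamma> k) G Kv Kr)) T \<longleftrightarrow>
    real_rational T \<and> (\<forall>\<^sub>F s in cofinite. T s = E a b c s)"
proof (rule is_transfer_function_iff)
  have \<gamma>': "\<forall>t\<ge>0::real. (\<Sum>k=1..m. \<gamma> k) = 1" using \<gamma> by simp
  show "ratf (E a b c)" by (rule ratfs)
  show "\<exists>V. channel a b c (multi_e1 m C D' Dk \<eta> (\<lambda>k t. \<gamma> k) G Kv Kr) u V" if "signal u" for u
    unfolding channel_def multi_e1_def
    using multi_exists[OF signal_cmult[OF that] signal_cmult[OF that] signal_cmult[OF that] signal_const \<gamma>'] by blast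
  show "block (E a b c) u e1"
    if "signal u" "channel a b c (multi_e1 m C D' Dk \<eta> (\<lambda>k t. \<gamma> k) G Kv Kr) u e1" for u e1
    using that multi_error(1)[OF _ that(1) signal_const \<gamma>'] unfolding channel_def multi_e1_def by blast
qed

lemma multi_current_transfer_function:
  assumes k: "k \<in> {1..m}"
  shows "is_transfer_function (channel a b c (multi_current m C D' Dk \<eta> (\<lambda>k t. \<gamma> k) G Kv Kr k)) T \<longleftrightarrow>
    real_rational T \<and> (\<forall>\<^sub>F s in cofinite. T s = I (\<gamma> k) a b c s)"
proof (rule is_transfer_function_iff)
  have \<gamma>': "\<forall>t\<ge>0::real. (\<Sum>k=1..m. \<gamma> k) = 1" using \<gamma> by simp
  show "ratf (I (\<gamma> k) a b c)" by (rule ratfs)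
  show "\<exists>V. channel a b c (multi_current m C D' Dk \<eta> (\<lambda>k t. \<gamma> k) G Kv Kr k) u V" if "signal u" for u
    unfolding channel_def multi_current_def
    using multi_exists[OF signal_cmult[OF that] signal_cmult[OF that] signal_cmult[OF that] signal_const \<gamma>'] by blast
  show "block (I (\<gamma> k) a b c) u y"
    if "signal u" "channel a b c (multi_current m C D' Dk \<eta> (\<lambda>k t. \<gamma> k) G Kv Kr k) u y" for u y
    using that(2) multi_current_block[OF _ that(1) \<gamma> k] unfolding channel_def multi_current_def by blast
qed

lemma steady_state_e1:
  "steady_state (multi_e1 m C D' Dk \<eta> (\<lambda>k t. \<gamma> k) G Kv Kr) v r l e \<longleftrightarrow>
    e = ((1 + of_real D' * kr0) * of_real l - of_real D' * kr0 * of_real r) /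
      (of_real D' * (kv0 + of_real \<eta> * kr0))"
  unfolding steady_state_iff[OF multi_e1_transfer_function ratfs(6) E_0]
  by (simp add: E0_def add_divide_distrib[symmetric] diff_divide_distrib[symmetric] algebra_simps)

lemma steady_state_current_exists:
  "k \<in> {1..m} \<Longrightarrow> \<exists>x. steady_state (multi_current m C D' Dk \<eta> (\<lambda>k t. \<gamma> k) G Kv Kr k) v r l x"
  unfolding steady_state_iff[OF multi_current_transfer_function ratfs(7) I_0] by blast

end

text \<open>\<open>dc_gain\<close> is defined by \<open>Lim\<close>, which is meaningful only once
  the limit is known to exist; \<open>nz1\<close> keeps the denominator away from
  \<open>0\<close>.\<close>

lemma T2_0: "(T2_tilde m D' G Kv Kr \<longlongrightarrow> dc_gain (T2_tilde m D' G Kv Kr)) (at 0)"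
proof -
  have "T2_tilde m D' G Kv Kr = (\<lambda>s. H s * Kv s / (of_nat m * S s))"
    by (simp add: fun_eq_iff T2_tilde_def H_def S_def)
  moreover have "((\<lambda>s. H s * Kv s / (of_nat m * S s)) \<longlongrightarrow>
      of_real D' * kv0 / (of_nat m * (1 + of_real D' * kr0))) (at 0)"
    by (intro tendsto_intros H_0 S_0 Kv_0) (use m nz1 in simp)
  ultimately have *: "(T2_tilde m D' G Kv Kr \<longlongrightarrow>
      of_real D' * kv0 / (of_nat m * (1 + of_real D' * kr0))) (at 0)" by simp
  have "dc_gain (T2_tilde m D' G Kv Kr) = of_real D' * kv0 / (of_nat m * (1 + of_real D' * kr0))"
    unfolding dc_gain_def by (rule tendsto_Lim[OF trivial_limit_at *])
  with * show ?thesis by simp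
qed

lemma ratf_T2: "ratf (T2_tilde m D' G Kv Kr)"
  unfolding T2_tilde_def[abs_def] by (intro ratf_intros ratf_G ratf_Kv ratf_Kr)

text \<open>The transfer functions are compared along one common solution, the response to a unit step.\<close>

lemma channel_gain_difference:
  assumes k: "k \<in> {1..m}" "\<gamma> k > 0" and l: "l \<in> {1..m}" "\<gamma> l > 0"
    and Tk: "is_transfer_function (channel a b c (multi_current m C D' Dk \<eta> (\<lambda>k t. \<gamma> k) G Kv Kr k)) Tk"
      "(Tk \<longlongrightarrow> gk) (at 0)"
    and Tl: "is_transfer_function (channel a b c (multi_current m C D' Dk \<eta> (\<lambda>k t. \<gamma> k) G Kv Kr l)) Tl"
      "(Tl \<longlongrightarrow> gl) (at 0)"
    and Te: "is_transfer_function (channel a b c (multi_e1 m C D' Dk \<eta> (\<lambda>k t. \<gamma> k) G Kv Kr)) Te"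
      "(Te \<longlongrightarrow> ge) (at 0)"
  shows "gk / of_real (\<gamma> k) - gl / of_real (\<gamma> l) =
    dc_gain (T2_tilde m D' G Kv Kr) * (1 / of_real (\<gamma> k) - 1 / of_real (\<gamma> l)) * ge"
proof -
  let ?u = "\<lambda>_::real. 1::real"
  let ?d = "1 / of_real (\<gamma> k) - 1 / of_real (\<gamma> l) :: complex"
  have rat: "ratf Tk" "ratf Tl" "ratf Te"
    using Tk(1) Tl(1) Te(1) unfolding is_transfer_function_def by (auto intro: real_rational_ratf)
  \<comment> \<open>No solution is constructed here: the assumed transfer function of the error
    guarantees an output for every signal.\<close>
  have "\<exists>y. channel a b c (multi_e1 m C D' Dk \<eta> (\<lambda>k t. \<gamma> k) G Kv Kr) ?u y"
    using Te(1) signal_const unfolding is_transfer_function_def by blast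
  then obtain e1 e2 i iL V where M:
    "multi_system m C D' Dk \<eta> (\<lambda>k t. \<gamma> k) G Kv Kr (\<lambda>t. a * ?u t) (\<lambda>t. b * ?u t) (\<lambda>t. c * ?u t) e1 e2 i iL V"
    unfolding channel_def multi_e1_def by blast
  have "channel a b c (multi_e1 m C D' Dk \<eta> (\<lambda>k t. \<gamma> k) G Kv Kr) ?u e1"
    unfolding channel_def multi_e1_def by (intro exI) (rule M)
  from is_transfer_functionD[OF Te(1), OF signal_const, OF this] have "block Te ?u e1" .
  moreover have "channel a b c (multi_current m C D' Dk \<eta> (\<lambda>k t. \<gamma> k) G Kv Kr k) ?u (\<lambda>t. Dk k * iL k t)"
    unfolding channel_def multi_current_def by (intro exI conjI) (rule M, rule refl)
  from is_transfer_functionD[OF Tk(1), OF signal_const, OF this] have "block Tk ?u (\<lambda>t. Dk k * iL k t)" .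
  moreover have "channel a b c (multi_current m C D' Dk \<eta> (\<lambda>k t. \<gamma> k) G Kv Kr l) ?u (\<lambda>t. Dk l * iL l t)"
    unfolding channel_def multi_current_def by (intro exI conjI) (rule M, rule refl)
  from is_transfer_functionD[OF Tl(1), OF signal_const, OF this] have "block Tl ?u (\<lambda>t. Dk l * iL l t)" .
  ultimately have ev: "\<forall>\<^sub>F s in rhp. laplace e1 s = Te s * laplace ?u s"
    "\<forall>\<^sub>F s in rhp. laplace (\<lambda>t. Dk k * iL k t) s = Tk s * laplace ?u s"
    "\<forall>\<^sub>F s in rhp. laplace (\<lambda>t. Dk l * iL l t) s = Tl s * laplace ?u s"
    unfolding block_iff by auto
  have "signal (\<lambda>t. b * ?u t)" by (rule signal_const)
  from ev eventually_rhp_gt[of 0] current_difference[OF M this k(2) l(2) k(1) l(1)]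
  have "\<forall>\<^sub>F s in rhp. Tk s / of_real (\<gamma> k) - Tl s / of_real (\<gamma> l) = T2_tilde m D' G Kv Kr s * ?d * Te s"
  proof eventually_elim
    case (elim s)
    then have s: "s \<noteq> 0" by auto
    have "(Tk s / of_real (\<gamma> k) - Tl s / of_real (\<gamma> l)) * laplace ?u s =
        (T2_tilde m D' G Kv Kr s * ?d * Te s) * laplace ?u s"
      using elim(5) unfolding elim(1-3) by (simp add: algebra_simps)
    moreover have "laplace ?u s \<noteq> 0" using s elim(4) by (simp add: laplace_one)
    ultimately show ?case by (simp only: mult_cancel_right) simp
  qed
  moreover have "ratf (\<lambda>s. Tk s / of_real (\<gamma> k) - Tl s / of_real (\<gamma> l))" by (intro ratf_intros rat)
  moreover have "ratf (\<lambda>s. T2_tilde m D' G Kv Kr s * ?d * Te s)"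
    using ratf_of_real[of 1] by (intro ratf_intros rat ratf_T2)
  ultimately have "\<forall>\<^sub>F s in cofinite. Tk s / of_real (\<gamma> k) - Tl s / of_real (\<gamma> l) =
      T2_tilde m D' G Kv Kr s * ?d * Te s"
    by (intro ratf_eq_cofinite)
  then have "\<forall>\<^sub>F s in at 0. Tk s / of_real (\<gamma> k) - Tl s / of_real (\<gamma> l) =
      T2_tilde m D' G Kv Kr s * ?d * Te s"
    by (rule filter_leD[OF at_le_cofinite])
  moreover have "((\<lambda>s. Tk s / of_real (\<gamma> k) - Tl s / of_real (\<gamma> l)) \<longlongrightarrow>
      gk / of_real (\<gamma> k) - gl / of_real (\<gamma> l)) (at 0)"
    using k l by (intro tendsto_intros Tk Tl) auto
  ultimately have "((\<lambda>s. T2_tilde m D' G Kv Kr s * ?d * Te s) \<longlongrightarrow>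
      gk / of_real (\<gamma> k) - gl / of_real (\<gamma> l)) (at 0)"
    by (rule Lim_transform_eventually[rotated])
  moreover have "((\<lambda>s. T2_tilde m D' G Kv Kr s * ?d * Te s) \<longlongrightarrow>
      dc_gain (T2_tilde m D' G Kv Kr) * ?d * ge) (at 0)"
    by (intro tendsto_mult T2_0 tendsto_const Te)
  ultimately show ?thesis by (rule LIM_unique)
qed

text \<open>The factor relating the gains is the same in all three channels, so it survives their
  superposition with the weights \<open>v0\<close>, \<open>r0\<close>, \<open>l0\<close>.\<close>

lemma steady_state_difference:
  assumes k: "k \<in> {1..m}" "\<gamma> k > 0" and l: "l \<in> {1..m}" "\<gamma> l > 0"
    and "steady_state (multi_current m C D' Dk \<eta> (\<lambda>k t. \<gamma> k) G Kv Kr k) v0 r0 l0 xk"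
    and "steady_state (multi_current m C D' Dk \<eta> (\<lambda>k t. \<gamma> k) G Kv Kr l) v0 r0 l0 xl"
    and "steady_state (multi_e1 m C D' Dk \<eta> (\<lambda>k t. \<gamma> k) G Kv Kr) v0 r0 l0 e"
  shows "xk / of_real (\<gamma> k) - xl / of_real (\<gamma> l) =
    dc_gain (T2_tilde m D' G Kv Kr) * (1 / of_real (\<gamma> k) - 1 / of_real (\<gamma> l)) * e"
proof -
  obtain T1 T2 T3 kv kr kl where k': "is_transfer_function (channel 1 0 0 (multi_current m C D' Dk \<eta> (\<lambda>k t. \<gamma> k) G Kv Kr k)) T1"
    "(T1 \<longlongrightarrow> kv) (at 0)" "is_transfer_function (channel 0 1 0 (multi_current m C D' Dk \<eta> (\<lambda>k t. \<gamma> k) G Kv Kr k)) T2"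
    "(T2 \<longlongrightarrow> kr) (at 0)" "is_transfer_function (channel 0 0 1 (multi_current m C D' Dk \<eta> (\<lambda>k t. \<gamma> k) G Kv Kr k)) T3"
    "(T3 \<longlongrightarrow> kl) (at 0)" and xk: "xk = kv * of_real v0 + kr * of_real r0 + kl * of_real l0"
    using assms(5) unfolding steady_state_def from_channel by blast
  obtain T1 T2 T3 lv lr ll where l': "is_transfer_function (channel 1 0 0 (multi_current m C D' Dk \<eta> (\<lambda>k t. \<gamma> k) G Kv Kr l)) T1"
    "(T1 \<longlongrightarrow> lv) (at 0)" "is_transfer_function (channel 0 1 0 (multi_current m C D' Dk \<eta> (\<lambda>k t. \<gamma> k) G Kv Kr l)) T2"
    "(T2 \<longlongrightarrow> lr) (at 0)" "is_transfer_function (channel 0 0 1 (multi_current m C D' Dk \<eta> (\<lambda>k t. \<gamma> k) G Kv Kr l)) T3"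
    "(T3 \<longlongrightarrow> ll) (at 0)" and xl: "xl = lv * of_real v0 + lr * of_real r0 + ll * of_real l0"
    using assms(6) unfolding steady_state_def from_channel by blast
  obtain T1 T2 T3 ev er el where e': "is_transfer_function (channel 1 0 0 (multi_e1 m C D' Dk \<eta> (\<lambda>k t. \<gamma> k) G Kv Kr)) T1"
    "(T1 \<longlongrightarrow> ev) (at 0)" "is_transfer_function (channel 0 1 0 (multi_e1 m C D' Dk \<eta> (\<lambda>k t. \<gamma> k) G Kv Kr)) T2"
    "(T2 \<longlongrightarrow> er) (at 0)" "is_transfer_function (channel 0 0 1 (multi_e1 m C D' Dk \<eta> (\<lambda>k t. \<gamma> k) G Kv Kr)) T3"
    "(T3 \<longlongrightarrow> el) (at 0)" and e: "e = ev * of_real v0 + er * of_real r0 + el * of_real l0"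
    using assms(7) unfolding steady_state_def from_channel by blast
  let ?K = "dc_gain (T2_tilde m D' G Kv Kr) * (1 / of_real (\<gamma> k) - 1 / of_real (\<gamma> l))"
  have "kv / of_real (\<gamma> k) - lv / of_real (\<gamma> l) = ?K * ev"
    "kr / of_real (\<gamma> k) - lr / of_real (\<gamma> l) = ?K * er"
    "kl / of_real (\<gamma> k) - ll / of_real (\<gamma> l) = ?K * el"
    by (rule channel_gain_difference[of k \<gamma> l, OF k l k'(1,2) l'(1,2) e'(1,2)]
        channel_gain_difference[of k \<gamma> l, OF k l k'(3,4) l'(3,4) e'(3,4)]
        channel_gain_difference[of k \<gamma> l, OF k l k'(5,6) l'(5,6) e'(5,6)])+
  moreover have "xk / of_real (\<gamma> k) - xl / of_real (\<gamma> l) =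
      (kv / of_real (\<gamma> k) - lv / of_real (\<gamma> l)) * of_real v0 +
      (kr / of_real (\<gamma> k) - lr / of_real (\<gamma> l)) * of_real r0 +
      (kl / of_real (\<gamma> k) - ll / of_real (\<gamma> l)) * of_real l0"
    by (simp add: xk xl add_divide_distrib diff_divide_distrib algebra_simps)
  ultimately show ?thesis by (simp only: e) (simp only: algebra_simps)
qed

end

section \<open>System equivalence, power sharing and the bounds on the tracking error\<close>

theorem theorem1:
  fixes m :: nat and C D' \<eta> \<omega> \<zeta>1 \<zeta>2 :: real and Dk :: "nat \<Rightarrow> real"
    and G Kv Kr :: "complex \<Rightarrow> complex"
  assumes "m \<ge> 1" and "C > 0" and "0 < D'" and "D' < 1" and "\<eta> \<ge> 0"
    and "\<forall>k\<in>{1..m}. 0 < Dk k \<and> Dk k \<le> 1"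
    and "\<omega> > omega0" and "\<zeta>1 > 0" and "\<zeta>2 > 0"
    and "G = inner_plant \<omega> \<zeta>1 \<zeta>2"
    and "proper_real_rational Kv" and "\<exists>c. (Kv \<longlongrightarrow> c) (at 0)"
    and "proper_real_rational Kr" and "\<exists>c. (Kr \<longlongrightarrow> c) (at 0)"
    and "1 + of_real D' * dc_gain Kr \<noteq> 0"
    and "dc_gain Kv + of_real \<eta> * dc_gain Kr \<noteq> 0"
  shows
    \<comment> \<open>system equivalence, with time-varying multipliers\<close>
    "(\<forall>\<gamma> :: nat \<Rightarrow> real \<Rightarrow> real.
        (\<forall>k\<in>{1..m}. signal (\<gamma> k) \<and> (\<forall>t\<ge>0. 0 < \<gamma> k t \<and> \<gamma> k t \<le> 1)) \<and>
        (\<forall>t\<ge>0. (\<Sum>k=1..m. \<gamma> k t) = 1) \<longrightarrow>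
        (\<forall>channel\<in>{from_vref, from_iref, from_iload}.
           (\<exists>T. is_transfer_function (channel (single_V C D' \<eta> G Kv Kr)) T) \<and>
           (\<forall>T. is_transfer_function (channel (multi_V m C D' Dk \<eta> \<gamma> G Kv Kr)) T \<longleftrightarrow>
                is_transfer_function (channel (single_V C D' \<eta> G Kv Kr)) T)))
     \<and>
     (\<forall>(\<gamma> :: nat \<Rightarrow> real) vref iref iload v0 r0 l0.
        (\<forall>k\<in>{1..m}. 0 < \<gamma> k \<and> \<gamma> k \<le> 1) \<and>
        signal vref \<and> (vref \<longlongrightarrow> v0) at_top \<and>
        signal iref \<and> (iref \<longlongrightarrow> r0) at_top \<and>
        signal iload \<and> (iload \<longlongrightarrow> l0) at_top \<longrightarrow>
        \<comment> \<open>power sharing\<close>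
        (\<forall>k\<in>{1..m}. \<forall>l\<in>{1..m}. \<forall>xk xl e.
           steady_state (multi_current m C D' Dk \<eta> (\<lambda>k t. \<gamma> k) G Kv Kr k) v0 r0 l0 xk \<and>
           steady_state (multi_current m C D' Dk \<eta> (\<lambda>k t. \<gamma> k) G Kv Kr l) v0 r0 l0 xl \<and>
           steady_state (multi_e1 m C D' Dk \<eta> (\<lambda>k t. \<gamma> k) G Kv Kr) v0 r0 l0 e \<longrightarrow>
           cmod (xk / of_real (\<gamma> k) - xl / of_real (\<gamma> l)) \<le>
             (\<eta> * cmod (dc_gain (T1_tilde D' G Kr)) +
              \<bar>1 / \<gamma> k - 1 / \<gamma> l\<bar> * cmod (dc_gain (T2_tilde m D' G Kv Kr))) * cmod e) \<and>
        ((\<Sum>k=1..m. \<gamma> k) = 1 \<longrightarrow>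
           \<comment> \<open>the steady-state values exist\<close>
           (\<forall>k\<in>{1..m}. \<exists>x.
              steady_state (multi_current m C D' Dk \<eta> (\<lambda>k t. \<gamma> k) G Kv Kr k) v0 r0 l0 x) \<and>
           (\<exists>e. steady_state (multi_e1 m C D' Dk \<eta> (\<lambda>k t. \<gamma> k) G Kv Kr) v0 r0 l0 e) \<and>
           \<comment> \<open>bounds on the tracking error\<close>
           (\<forall>e. steady_state (multi_e1 m C D' Dk \<eta> (\<lambda>k t. \<gamma> k) G Kv Kr) v0 r0 l0 e \<longrightarrow>
              ((\<forall>t\<ge>0. iref t = iload t) \<longrightarrow>
                 cmod e \<le> 1 / (D' * cmod (dc_gain Kv + of_real \<eta> * dc_gain Kr)) * \<bar>r0\<bar>) \<and>
              (\<not> (\<forall>t\<ge>0. iref t = iload t) \<longrightarrow>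
                 cmod e \<le>
                   cmod (dc_gain Kr) / (D' * cmod (dc_gain Kv + of_real \<eta> * dc_gain Kr)) * \<bar>r0\<bar> +
                   (D' * cmod (dc_gain Kr) + 1) /
                     (D' * cmod (dc_gain Kv + of_real \<eta> * dc_gain Kr)) * \<bar>l0\<bar>))))"
proof -
  obtain kv kr where kv: "(Kv \<longlongrightarrow> kv) at_infinity" and kr: "(Kr \<longlongrightarrow> kr) at_infinity"
    using proper_real_rational_tendsto assms(11,13) by blast
  have Kv0: "(Kv \<longlongrightarrow> dc_gain Kv) (at 0)" and Kr0: "(Kr \<longlongrightarrow> dc_gain Kr) (at 0)"
    unfolding dc_gain_def using assms(12,14) tendsto_Lim[OF trivial_limit_at] by metis+
  have rat: "ratf Kv" "ratf Kr"
    by (intro proper_real_rational_ratf assms(11,13))+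
  interpret dc_microgrid m C D' \<eta> Dk G Kv Kr kv kr "dc_gain Kv" "dc_gain Kr"
    by unfold_locales
      (use assms omega0_pos rat kv kr Kv0 Kr0 in
        \<open>auto intro: inner_plant_ratf inner_plant_at_infinity inner_plant_at_0\<close>)
  show ?thesis
  proof (rule conjI, goal_cases)
    case 1
    show ?case
    proof (intro allI impI ballI, elim conjE, goal_cases)
      case (1 \<gamma> ch)
      then have \<gamma>: "\<And>k. k \<in> {1..m} \<Longrightarrow> signal (\<gamma> k)" "\<forall>t\<ge>0. (\<Sum>k=1..m. \<gamma> k t) = 1" by auto
      from 1(1) obtain a b c where ch: "ch = channel a b c" unfolding from_channel by blast
      obtain T where T: "real_rational T" "\<forall>\<^sub>F s in cofinite. of_real a - E a b c s = T s"
        using ratf_diff[OF ratf_of_real ratfs(6)] unfolding ratf_def by blast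
      from T(2) have "\<forall>\<^sub>F s in cofinite. T s = of_real a - E a b c s" by eventually_elim simp
      with T(1) have "\<exists>T. is_transfer_function (ch (single_V C D' \<eta> G Kv Kr)) T"
        unfolding ch single_transfer_function by blast
      moreover have "is_transfer_function (ch (multi_V m C D' Dk \<eta> \<gamma> G Kv Kr)) T' \<longleftrightarrow>
          is_transfer_function (ch (single_V C D' \<eta> G Kv Kr)) T'" for T'
        unfolding ch single_transfer_function by (rule multi_V_transfer_function) (fact \<gamma>)+
      ultimately show ?case by blast
    qed
  next
    case 2
    show ?case
    proof (intro allI impI, elim conjE, goal_cases)
      case (1 \<gamma> vref iref iload v0 r0 l0)
      then have \<gamma>: "\<gamma> k > 0" if "k \<in> {1..m}" for k using that by blast
      show ?case
      proof (intro conjI ballI allI impI, goal_cases)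
        case (1 k l xk xl e)
        then have "cmod (xk / of_real (\<gamma> k) - xl / of_real (\<gamma> l)) =
            cmod (dc_gain (T2_tilde m D' G Kv Kr)) * cmod (of_real (1 / \<gamma> k - 1 / \<gamma> l)) * cmod e"
          using steady_state_difference[of k \<gamma> l v0 r0 l0 xk xl e] \<gamma> by (simp add: norm_mult)
        also have "\<dots> = (\<bar>1 / \<gamma> k - 1 / \<gamma> l\<bar> * cmod (dc_gain (T2_tilde m D' G Kv Kr))) * cmod e"
          unfolding norm_of_real by (simp only: mult_ac)
        also have "\<dots> \<le> (\<eta> * cmod (dc_gain (T1_tilde D' G Kr)) +
            \<bar>1 / \<gamma> k - 1 / \<gamma> l\<bar> * cmod (dc_gain (T2_tilde m D' G Kv Kr))) * cmod e"
          using \<eta> by (intro mult_right_mono) auto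
        finally show ?case .
      next
        case (2 k)
        then show ?case by (rule steady_state_current_exists)
      next
        case 3
        then show ?case unfolding steady_state_e1[OF 3] by blast
      next
        case (4 e)
        let ?X = "dc_gain Kv + of_real \<eta> * dc_gain Kr"
        have e: "e = ((1 + of_real D' * dc_gain Kr) * of_real l0 - of_real D' * dc_gain Kr * of_real r0) /
            (of_real D' * ?X)"
          using 4(2) unfolding steady_state_e1[OF 4(1)] .
        \<comment> \<open>Signals that agree for \<open>t \<ge> 0\<close> have the same limit. With
          \<open>r0 = l0\<close> the two \<open>Kr\<close> terms in the numerator of
          \<open>e\<close> cancel and only \<open>r0\<close> is left.\<close>
        have "r0 = l0"
        proof (rule tendsto_unique[OF trivial_limit_at_top_linorder])
          show "(iref \<longlongrightarrow> r0) at_top" by fact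
          have "\<forall>\<^sub>F t in at_top. iload t = iref t"
            using eventually_ge_at_top[of 0] by eventually_elim (use 4(3) in simp)
          with \<open>(iload \<longlongrightarrow> l0) at_top\<close> show "(iref \<longlongrightarrow> l0) at_top"
            by (rule Lim_transform_eventually)
        qed
        then have "e = of_real r0 / (of_real D' * ?X)" unfolding e by (simp add: algebra_simps)
        then show ?case using D' by (simp add: norm_divide norm_mult)
      next
        case (5 e)
        let ?X = "dc_gain Kv + of_real \<eta> * dc_gain Kr"
        have e: "e = ((1 + of_real D' * dc_gain Kr) * of_real l0 - of_real D' * dc_gain Kr * of_real r0) /
            (of_real D' * ?X)"
          using 5(2) unfolding steady_state_e1[OF 5(1)] .
        have "cmod ((1 + of_real D' * dc_gain Kr) * of_real l0) \<le> (D' * cmod (dc_gain Kr) + 1) * \<bar>l0\<bar>"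
          using norm_triangle_ineq[of 1 "of_real D' * dc_gain Kr"] D'
          by (simp add: norm_mult mult_right_mono)
        \<comment> \<open>The stated coefficient of \<open>r0\<close> has no factor
          \<open>D'\<close> in its numerator; \<open>D' < 1\<close> allows it to be dropped.\<close>
        moreover have "cmod (of_real D' * dc_gain Kr * of_real r0) \<le> cmod (dc_gain Kr) * \<bar>r0\<bar>"
          using D' by (simp add: norm_mult mult_right_mono mult_left_le_one_le)
        ultimately have "cmod ((1 + of_real D' * dc_gain Kr) * of_real l0 - of_real D' * dc_gain Kr * of_real r0)
            \<le> cmod (dc_gain Kr) * \<bar>r0\<bar> + (D' * cmod (dc_gain Kr) + 1) * \<bar>l0\<bar>"
          by (intro order_trans[OF norm_triangle_ineq4]) simp
        then have "cmod e \<le> (cmod (dc_gain Kr) * \<bar>r0\<bar> + (D' * cmod (dc_gain Kr) + 1) * \<bar>l0\<bar>) /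
            (D' * cmod ?X)"
          unfolding e using D' by (simp add: norm_divide norm_mult divide_right_mono)
        then show ?case
          unfolding add_divide_distrib[of "cmod (dc_gain Kr) * \<bar>r0\<bar>"] times_divide_eq_left[symmetric]
          by (simp only: mult_ac times_divide_eq_left times_divide_eq_right)
      qed
    qed
  qed
qed

end
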